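(* Let $q$ be a nonzero complex number, let $n\ge 1$ and $0\le r<n$ be integers, and consider the quantum matrix algebra $M_q(2n)$ with its quantum minors $\xi^{I}_{J}$. Then $$\sum_{\sigma}(-q)^{l(\sigma)}\,\xi^{1,\dots,n}_{i_1,\dots,i_n}\,\xi^{1,\dots,n}_{i_{n+1},\dots,i_{2n}}=0,$$ $$\sum_{\sigma}(-q)^{-l(\sigma)}\,\xi^{1,\dots,n}_{i_{n+1},\dots,i_{2n}}\,\xi^{1,\dots,n}_{i_1,\dots,i_n}=0,$$ where both sums run over all permutations $\sigma=\begin{pmatrix}1&2&\cdots&2n\\ i_1&i_2&\cdots&i_{2n}\end{pmatrix}\in S_{2n}$ such that $i_k=k$ for $1\le k\le r$, $i_{r+1}<i_{r+2}<\cdots<i_n$, and $i_{n+1}<i_{n+2}<\cdots<i_{2n}$.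
   Context: $M_q(N)$ is the unital associative complex algebra generated by $a_{ij}$, $1\le i,j\le N$, subject to the relations, for all $i<j$ and $k<l$: $a_{ik}a_{il}=qa_{il}a_{ik}$, $a_{ik}a_{jk}=qa_{jk}a_{ik}$, $a_{jk}a_{il}=a_{il}a_{jk}$, $a_{ik}a_{jl}-a_{jl}a_{ik}=(q-q^{-1})a_{il}a_{jk}$. For $i_1<\cdots<i_s$ and $j_1<\cdots<j_s$ in $\{1,\dots,N\}$ the quantum minor (rows on top, columns below) is $\xi^{i_1,\dots,i_s}_{j_1,\dots,j_s}=\sum_{\sigma\in S_s}(-q)^{l(\sigma)}a_{i_1,j_{\sigma(1)}}\cdots a_{i_s,j_{\sigma(s)}}$. Here $l(\sigma)$ denotes the number of inversions of the permutation $\sigma$. *)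

theory Defs
  imports Complex_Main "HOL-Algebra.QuotRing" "HOL-Algebra.Module" "HOL-Combinatorics.Permutations"
begin

section \<open>The free unital complex algebra on a set\<close>

text \<open>Elements are finitely supported functions on words over \<open>X\<close>. In the product, the
  coefficient at \<open>w\<close> sums over all factorisations of \<open>w\<close> into a prefix and a suffix.\<close>

definition free_algebra :: "'a set \<Rightarrow> (complex, 'a list \<Rightarrow> complex) module" where
  "free_algebra X =
    \<lparr>carrier = {f. finite {w. f w \<noteq> 0} \<and> {w. f w \<noteq> 0} \<subseteq> lists X},
     monoid.mult = (\<lambda>f g w. \<Sum>k\<le>length w. f (take k w) * g (drop k w)),
     one = (\<lambda>w. if w = [] then 1 else 0),
     zero = (\<lambda>w. 0),
     add = (\<lambda>f g w. f w + g w),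
     smult = (\<lambda>c f w. c * f w)\<rparr>"

definition var :: "'a \<Rightarrow> 'a list \<Rightarrow> complex" where
  "var x = (\<lambda>w. if w = [x] then 1 else 0)"

lemma free_algebra_mult_closed:
  assumes "f \<in> carrier (free_algebra X)" "g \<in> carrier (free_algebra X)"
  shows "f \<otimes>\<^bsub>free_algebra X\<^esub> g \<in> carrier (free_algebra X)"
proof -
  let ?S = "\<lambda>h::'a list \<Rightarrow> complex. {w. h w \<noteq> 0}"
  let ?h = "f \<otimes>\<^bsub>free_algebra X\<^esub> g"
  have sub: "?S ?h \<subseteq> (\<lambda>(u, v). u @ v) ` (?S f \<times> ?S g)"
  proof
    fix w assume "w \<in> ?S ?h"
    then have "(\<Sum>k\<le>length w. f (take k w) * g (drop k w)) \<noteq> 0"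
      by (simp add: free_algebra_def)
    then obtain k where "f (take k w) * g (drop k w) \<noteq> 0"
      by (meson sum.not_neutral_contains_not_neutral)
    then have "(take k w, drop k w) \<in> ?S f \<times> ?S g" by simp
    then show "w \<in> (\<lambda>(u, v). u @ v) ` (?S f \<times> ?S g)"
      by (rule rev_image_eqI) simp
  qed
  have "finite ((\<lambda>(u, v). u @ v) ` (?S f \<times> ?S g))"
    using assms by (auto simp: free_algebra_def)
  moreover have "(\<lambda>(u, v). u @ v) ` (?S f \<times> ?S g) \<subseteq> lists X"
  proof (rule image_subsetI)
    fix p assume "p \<in> ?S f \<times> ?S g"
    then have "fst p \<in> lists X" "snd p \<in> lists X"
      using assms by (auto simp: free_algebra_def simp del: in_lists_conv_set)
    then show "(case p of (u, v) \<Rightarrow> u @ v) \<in> lists X" by (simp add: split_beta)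
  qed
  ultimately show ?thesis
    using sub finite_subset[OF sub] subset_trans[OF sub] by (simp add: free_algebra_def)
qed

lemma free_algebra_mult_assoc:
  "(f \<otimes>\<^bsub>free_algebra X\<^esub> g) \<otimes>\<^bsub>free_algebra X\<^esub> h =
    f \<otimes>\<^bsub>free_algebra X\<^esub> (g \<otimes>\<^bsub>free_algebra X\<^esub> h)"
proof
  fix w :: "'a list"
  let ?n = "length w"
  have "((f \<otimes>\<^bsub>free_algebra X\<^esub> g) \<otimes>\<^bsub>free_algebra X\<^esub> h) w =
    (\<Sum>k\<le>?n. \<Sum>j\<le>k. f (take j w) * g (drop j (take k w)) * h (drop k w))"
    by (auto simp: free_algebra_def sum_distrib_right min_absorb1 min_absorb2 intro!: sum.cong)
  also have "\<dots> = (\<Sum>(k, j)\<in>Sigma {..?n} (\<lambda>k. {..k}).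
      f (take j w) * g (drop j (take k w)) * h (drop k w))"
    by (simp add: sum.Sigma)
  also have "\<dots> = (\<Sum>(j, i)\<in>Sigma {..?n} (\<lambda>j. {..?n - j}).
      f (take j w) * (g (take i (drop j w)) * h (drop i (drop j w))))"
    by (rule sum.reindex_bij_witness[where i = "\<lambda>(j, i). (j + i, j)" and j = "\<lambda>(k, j). (j, k - j)"])
      (auto simp: drop_take add.commute)
  also have "\<dots> = (\<Sum>j\<le>?n. \<Sum>i\<le>?n - j.
      f (take j w) * (g (take i (drop j w)) * h (drop i (drop j w))))"
    by (simp add: sum.Sigma)
  also have "\<dots> = (f \<otimes>\<^bsub>free_algebra X\<^esub> (g \<otimes>\<^bsub>free_algebra X\<^esub> h)) w"
    by (simp add: free_algebra_def sum_distrib_left)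
  finally show "((f \<otimes>\<^bsub>free_algebra X\<^esub> g) \<otimes>\<^bsub>free_algebra X\<^esub> h) w =
    (f \<otimes>\<^bsub>free_algebra X\<^esub> (g \<otimes>\<^bsub>free_algebra X\<^esub> h)) w" .
qed

lemma free_algebra_one:
  "\<one>\<^bsub>free_algebra X\<^esub> \<otimes>\<^bsub>free_algebra X\<^esub> f = f" "f \<otimes>\<^bsub>free_algebra X\<^esub> \<one>\<^bsub>free_algebra X\<^esub> = f"
proof -
  show "\<one>\<^bsub>free_algebra X\<^esub> \<otimes>\<^bsub>free_algebra X\<^esub> f = f"
  proof
    fix w :: "'a list"
    have "(\<Sum>k\<le>length w. (if take k w = [] then 1 else 0) * f (drop k w)) =
      (\<Sum>k\<le>length w. if k = 0 then f w else 0)"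
      by (intro sum.cong) auto
    then show "(\<one>\<^bsub>free_algebra X\<^esub> \<otimes>\<^bsub>free_algebra X\<^esub> f) w = f w"
      by (simp add: free_algebra_def)
  qed
  show "f \<otimes>\<^bsub>free_algebra X\<^esub> \<one>\<^bsub>free_algebra X\<^esub> = f"
  proof
    fix w :: "'a list"
    have "(\<Sum>k\<le>length w. f (take k w) * (if drop k w = [] then 1 else 0)) =
      (\<Sum>k\<le>length w. if k = length w then f w else 0)"
      by (intro sum.cong) auto
    then show "(f \<otimes>\<^bsub>free_algebra X\<^esub> \<one>\<^bsub>free_algebra X\<^esub>) w = f w"
      by (simp add: free_algebra_def)
  qed
qed

lemma ring_free_algebra: "ring (free_algebra X)"
proof (rule ringI)
  let ?F = "free_algebra X"
  have add_closed: "f \<oplus>\<^bsub>?F\<^esub> g \<in> carrier ?F" if "f \<in> carrier ?F" "g \<in> carrier ?F" for f g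
  proof -
    have "{w. f w + g w \<noteq> 0} \<subseteq> {w. f w \<noteq> 0} \<union> {w. g w \<noteq> 0}" by auto
    from finite_subset[OF this] subset_trans[OF this] that show ?thesis
      by (simp add: free_algebra_def)
  qed
  show "abelian_group ?F"
  proof (rule abelian_groupI)
    show "\<exists>g\<in>carrier ?F. g \<oplus>\<^bsub>?F\<^esub> f = \<zero>\<^bsub>?F\<^esub>" if "f \<in> carrier ?F" for f
      using that by (intro bexI[of _ "\<lambda>w. - f w"]) (auto simp: free_algebra_def)
  qed (auto intro: add_closed, auto simp: free_algebra_def algebra_simps)
  show "Group.monoid ?F"
    by (rule monoidI)
      (auto simp: free_algebra_mult_closed free_algebra_mult_assoc free_algebra_one,
       auto simp: free_algebra_def)
  show "(f \<oplus>\<^bsub>?F\<^esub> g) \<otimes>\<^bsub>?F\<^esub> h = f \<otimes>\<^bsub>?F\<^esub> h \<oplus>\<^bsub>?F\<^esub> g \<otimes>\<^bsub>?F\<^esub> h" for f g h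
    by (simp add: free_algebra_def ring_distribs sum.distrib)
  show "h \<otimes>\<^bsub>?F\<^esub> (f \<oplus>\<^bsub>?F\<^esub> g) = h \<otimes>\<^bsub>?F\<^esub> f \<oplus>\<^bsub>?F\<^esub> h \<otimes>\<^bsub>?F\<^esub> g" for f g h
    by (simp add: free_algebra_def ring_distribs sum.distrib)
qed


section \<open>Quantum matrix algebra\<close>

abbreviation qmat_free :: "nat \<Rightarrow> (complex, (nat \<times> nat) list \<Rightarrow> complex) module" where
  "qmat_free N \<equiv> free_algebra ({1..N} \<times> {1..N})"

text \<open>Each relation is imposed for all values of the indices occurring in it; in particular the
  same-row relation holds in every row, and the same-column relation in every column.\<close>

definition qmat_relators :: "complex \<Rightarrow> nat \<Rightarrow> ((nat \<times> nat) list \<Rightarrow> complex) set" where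
  "qmat_relators q N = (let F = qmat_free N; x = (\<lambda>i j. var (i, j)) in
     {x i k \<otimes>\<^bsub>F\<^esub> x i l \<ominus>\<^bsub>F\<^esub> q \<odot>\<^bsub>F\<^esub> (x i l \<otimes>\<^bsub>F\<^esub> x i k) | i k l.
        i \<in> {1..N} \<and> k \<in> {1..N} \<and> l \<in> {1..N} \<and> k < l}
   \<union> {x i k \<otimes>\<^bsub>F\<^esub> x j k \<ominus>\<^bsub>F\<^esub> q \<odot>\<^bsub>F\<^esub> (x j k \<otimes>\<^bsub>F\<^esub> x i k) | i j k.
        i \<in> {1..N} \<and> j \<in> {1..N} \<and> k \<in> {1..N} \<and> i < j}
   \<union> {x j k \<otimes>\<^bsub>F\<^esub> x i l \<ominus>\<^bsub>F\<^esub> x i l \<otimes>\<^bsub>F\<^esub> x j k | i j k l.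
        i \<in> {1..N} \<and> j \<in> {1..N} \<and> k \<in> {1..N} \<and> l \<in> {1..N} \<and> i < j \<and> k < l}
   \<union> {(x i k \<otimes>\<^bsub>F\<^esub> x j l \<ominus>\<^bsub>F\<^esub> x j l \<otimes>\<^bsub>F\<^esub> x i k)
         \<ominus>\<^bsub>F\<^esub> (q - inverse q) \<odot>\<^bsub>F\<^esub> (x i l \<otimes>\<^bsub>F\<^esub> x j k) | i j k l.
        i \<in> {1..N} \<and> j \<in> {1..N} \<and> k \<in> {1..N} \<and> l \<in> {1..N} \<and> i < j \<and> k < l})"

definition qmat_ideal :: "complex \<Rightarrow> nat \<Rightarrow> ((nat \<times> nat) list \<Rightarrow> complex) set" where
  "qmat_ideal q N = Idl\<^bsub>qmat_free N\<^esub> (qmat_relators q N)"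

text \<open>The quotient ring together with the scalar multiplication induced on cosets.\<close>

definition qmat :: "complex \<Rightarrow> nat \<Rightarrow> (complex, ((nat \<times> nat) list \<Rightarrow> complex) set) module" where
  "qmat q N = ring.extend (qmat_free N Quot qmat_ideal q N)
     (module.fields (\<lambda>c A. \<Union>f\<in>A. qmat_ideal q N +>\<^bsub>qmat_free N\<^esub> (c \<odot>\<^bsub>qmat_free N\<^esub> f)))"

definition qgen :: "complex \<Rightarrow> nat \<Rightarrow> nat \<Rightarrow> nat \<Rightarrow> ((nat \<times> nat) list \<Rightarrow> complex) set" where
  "qgen q N i j = qmat_ideal q N +>\<^bsub>qmat_free N\<^esub> var (i, j)"

lemma qmat_relators_carrier: "qmat_relators q N \<subseteq> carrier (qmat_free N)"
proof -
  interpret F: ring "qmat_free N" by (rule ring_free_algebra)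
  have v: "var (i, j) \<in> carrier (qmat_free N)" if "i \<in> {1..N}" "j \<in> {1..N}" for i j
    using that by (auto simp: var_def free_algebra_def)
  have s: "c \<odot>\<^bsub>qmat_free N\<^esub> f \<in> carrier (qmat_free N)" if "f \<in> carrier (qmat_free N)" for c f
    using that by (auto simp: free_algebra_def)
  show ?thesis
    by (auto simp: qmat_relators_def Let_def simp del: atLeastAtMost_iff One_nat_def intro!: v s)
qed

lemma ideal_qmat_ideal: "ideal (qmat_ideal q N) (qmat_free N)"
  unfolding qmat_ideal_def
  by (rule ring.genideal_ideal[OF ring_free_algebra qmat_relators_carrier])

lemma ring_extend:
  assumes "ring R"
  shows "ring (ring.extend R m)"
proof -
  interpret R: ring R by (rule assms)
  have sel: "carrier (ring.extend R m) = carrier R" "monoid.mult (ring.extend R m) = monoid.mult R"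
    "one (ring.extend R m) = one R" "zero (ring.extend R m) = zero R"
    "add (ring.extend R m) = add R"
    by (simp_all add: ring.extend_def)
  show ?thesis
  proof (rule ringI)
    show "abelian_group (ring.extend R m)"
    proof (rule abelian_groupI)
      show "\<exists>y\<in>carrier (ring.extend R m). y \<oplus>\<^bsub>ring.extend R m\<^esub> x = \<zero>\<^bsub>ring.extend R m\<^esub>"
        if "x \<in> carrier (ring.extend R m)" for x
        using that unfolding sel by (metis R.a_inv_closed R.l_neg)
    qed (simp_all add: sel R.a_assoc R.a_comm R.a_lcomm)
    show "Group.monoid (ring.extend R m)"
      by (rule monoidI) (simp_all add: sel R.m_assoc)
  qed (simp_all add: sel R.l_distr R.r_distr)
qed

lemma ring_qmat: "ring (qmat q N)"
  unfolding qmat_def by (intro ring_extend ideal.quotient_is_ring ideal_qmat_ideal)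

lemma smult_qmat_coset:
  assumes "f \<in> carrier (qmat_free N)"
  shows "c \<odot>\<^bsub>qmat q N\<^esub> (qmat_ideal q N +>\<^bsub>qmat_free N\<^esub> f) =
    qmat_ideal q N +>\<^bsub>qmat_free N\<^esub> (c \<odot>\<^bsub>qmat_free N\<^esub> f)"
proof -
  let ?F = "qmat_free N" and ?I = "qmat_ideal q N"
  interpret I: ideal ?I ?F by (rule ideal_qmat_ideal)
  have closed: "c \<odot>\<^bsub>?F\<^esub> g \<in> carrier ?F" if "g \<in> carrier ?F" for g
    using that by (auto simp: free_algebra_def)
  have smult: "c \<odot>\<^bsub>?F\<^esub> g = (c \<odot>\<^bsub>?F\<^esub> \<one>\<^bsub>?F\<^esub>) \<otimes>\<^bsub>?F\<^esub> g" for g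
  proof -
    have "(c \<odot>\<^bsub>?F\<^esub> \<one>\<^bsub>?F\<^esub>) \<otimes>\<^bsub>?F\<^esub> g = c \<odot>\<^bsub>?F\<^esub> (\<one>\<^bsub>?F\<^esub> \<otimes>\<^bsub>?F\<^esub> g)"
      by (simp add: free_algebra_def sum_distrib_left mult.assoc)
    then show ?thesis by (simp only: free_algebra_one)
  qed
  have same: "?I +>\<^bsub>?F\<^esub> (c \<odot>\<^bsub>?F\<^esub> g) = ?I +>\<^bsub>?F\<^esub> (c \<odot>\<^bsub>?F\<^esub> f)" if "g \<in> ?I +>\<^bsub>?F\<^esub> f" for g
  proof -
    obtain h where h: "h \<in> ?I" "g = h \<oplus>\<^bsub>?F\<^esub> f"
      using \<open>g \<in> ?I +>\<^bsub>?F\<^esub> f\<close> by (auto simp: a_r_coset_def r_coset_def)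
    have "c \<odot>\<^bsub>?F\<^esub> g = (c \<odot>\<^bsub>?F\<^esub> h) \<oplus>\<^bsub>?F\<^esub> (c \<odot>\<^bsub>?F\<^esub> f)"
      by (simp add: h free_algebra_def distrib_left)
    moreover have "c \<odot>\<^bsub>?F\<^esub> h \<in> ?I"
      unfolding smult[of h] by (intro I.I_l_closed closed I.one_closed h)
    ultimately have "c \<odot>\<^bsub>?F\<^esub> g \<in> ?I +>\<^bsub>?F\<^esub> (c \<odot>\<^bsub>?F\<^esub> f)"
      by (auto simp: a_r_coset_def r_coset_def)
    then show ?thesis
      by (rule I.a_repr_independence[OF _ closed[OF assms] I.a_subgroup, symmetric])
  qed
  have "f \<in> ?I +>\<^bsub>?F\<^esub> f" using assms by (rule I.a_rcos_self)
  then have "(\<Union>g\<in>?I +>\<^bsub>?F\<^esub> f. ?I +>\<^bsub>?F\<^esub> (c \<odot>\<^bsub>?F\<^esub> g)) = ?I +>\<^bsub>?F\<^esub> (c \<odot>\<^bsub>?F\<^esub> f)"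
    by (intro SUP_eq_const same) auto
  then show ?thesis
    by (simp add: qmat_def ring.extend_def module.fields_def)
qed


section \<open>Quantum minors\<close>

definition inversions :: "nat \<Rightarrow> (nat \<Rightarrow> nat) \<Rightarrow> nat" where
  "inversions m \<sigma> = card {(i, j). 1 \<le> i \<and> i < j \<and> j \<le> m \<and> \<sigma> j < \<sigma> i}"

text \<open>\<open>qminor q N s I J\<close> is the quantum minor of \<open>qmat q N\<close> with rows \<open>I 1 < \<dots> < I s\<close> and
  columns \<open>J 1 < \<dots> < J s\<close>; the values of \<open>I\<close> and \<open>J\<close> outside \<open>{1..s}\<close> are irrelevant. The
  factors of each monomial are multiplied in the order of their rows.\<close>

definition qminor ::
  "complex \<Rightarrow> nat \<Rightarrow> nat \<Rightarrow> (nat \<Rightarrow> nat) \<Rightarrow> (nat \<Rightarrow> nat) \<Rightarrow> ((nat \<times> nat) list \<Rightarrow> complex) set" where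
  "qminor q N s I J =
    (\<Oplus>\<^bsub>qmat q N\<^esub>\<sigma>\<in>{\<sigma>. \<sigma> permutes {1..s}}. (- q) ^ inversions s \<sigma> \<odot>\<^bsub>qmat q N\<^esub>
       foldr (\<lambda>k y. qgen q N (I k) (J (\<sigma> k)) \<otimes>\<^bsub>qmat q N\<^esub> y) [1..<Suc s] \<one>\<^bsub>qmat q N\<^esub>)"

definition plucker_perms :: "nat \<Rightarrow> nat \<Rightarrow> (nat \<Rightarrow> nat) set" where
  "plucker_perms n r = {\<sigma>. \<sigma> permutes {1..2 * n} \<and> (\<forall>k\<in>{1..r}. \<sigma> k = k) \<and>
     strict_mono_on {r + 1..n} \<sigma> \<and> strict_mono_on {n + 1..2 * n} \<sigma>}"

end

theory Submission
  imports Defs "HOL-Combinatorics.Multiset_Permutations"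
begin

text \<open>Let \<open>x\<^sub>1, x\<^sub>2, \<dots>\<close> satisfy \<open>x\<^sub>l x\<^sub>k = - q x\<^sub>k x\<^sub>l\<close> for \<open>k < l\<close> and \<open>x\<^sub>k x\<^sub>k = 0\<close>, and put
  \<open>\<omega>\<^sub>i = \<Sum>j. a\<^sub>i\<^sub>j x\<^sub>j\<close>. The quantum minors are the coefficients of products of the \<open>\<omega>\<^sub>i\<close>, and the relations
  of the quantum matrix algebra give \<open>\<omega>\<^sub>i \<omega>\<^sub>i = 0\<close> and \<open>\<omega>\<^sub>j \<omega>\<^sub>i = - q \<omega>\<^sub>i \<omega>\<^sub>j\<close> for \<open>i < j\<close>. Hence any
  product of the \<open>\<omega>\<^sub>i\<close> with a repeated index vanishes; comparing coefficients gives the case \<open>r = 0\<close>.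
  For \<open>r > 0\<close>, the minor whose columns contain \<open>1, \<dots>, r\<close> is expanded along these columns one after the
  other, with the column entries to the left for the first identity and to the right for the second.
  Since \<open>r < n\<close>, at least one row remains, and it still occurs among the rows of the other minor.\<close>

section \<open>Crossing numbers\<close>

text \<open>For disjoint \<open>A\<close> and \<open>B\<close> this is the exponent in
  \<open>x_A x_B = z ^ crossings A B x_(A Un B)\<close>: every pair whose larger index stands in
  front costs one exchange.\<close>

definition crossings :: "'a::linorder set \<Rightarrow> 'a set \<Rightarrow> nat" where
  "crossings A B = card {(x, y). x \<in> A \<and> y \<in> B \<and> y < x}"

lemma finite_crossings:
  "finite A \<Longrightarrow> finite B \<Longrightarrow> finite {(x, y). x \<in> A \<and> y \<in> B \<and> y < x}"
  by (rule finite_subset[of _ "A \<times> B"]) auto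

lemma crossings_Un_left:
  assumes "finite A" "finite A'" "finite B" "A \<inter> A' = {}"
  shows "crossings (A \<union> A') B = crossings A B + crossings A' B"
  unfolding crossings_def using assms
  by (subst card_Un_disjoint[symmetric]; (intro finite_crossings arg_cong[where f = card])?) auto

lemma crossings_Un_right:
  assumes "finite A" "finite B" "finite B'" "B \<inter> B' = {}"
  shows "crossings A (B \<union> B') = crossings A B + crossings A B'"
  unfolding crossings_def using assms
  by (subst card_Un_disjoint[symmetric]; (intro finite_crossings arg_cong[where f = card])?) auto

text \<open>Each pair of \<open>A \<times> B\<close> is out of order in exactly one of the two
  arrangements.\<close>

lemma crossings_swap:
  assumes "finite A" "finite B" "A \<inter> B = {}"
  shows "crossings A B + crossings B A = card A * card B"
proof -
  let ?X = "{(x, y). x \<in> A \<and> y \<in> B \<and> y < x}" and ?Y = "{(x, y). x \<in> B \<and> y \<in> A \<and> y < x}"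
  have "crossings B A = card (prod.swap ` ?Y)"
    unfolding crossings_def by (rule card_image[symmetric]) simp
  moreover have "card ?X + card (prod.swap ` ?Y) = card (?X \<union> prod.swap ` ?Y)"
    using assms by (intro card_Un_disjoint[symmetric] finite_imageI finite_crossings) auto
  moreover have "?X \<union> prod.swap ` ?Y = A \<times> B"
    using assms(3) by (force simp: image_iff)
  ultimately show ?thesis by (simp add: crossings_def card_cartesian_product)
qed

lemma crossings_singletons [simp]: "crossings {x} {y} = (if y < x then 1 else 0)"
proof -
  have "{(x', y'). x' \<in> {x} \<and> y' \<in> {y} \<and> y' < x'} = (if y < x then {(x, y)} else {})" by auto
  then show ?thesis by (simp add: crossings_def)
qed

lemma crossings_empty [simp]: "crossings {} B = 0" "crossings A {} = 0"
  by (simp_all add: crossings_def)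

lemma crossings_eq_0: "(\<And>x y. x \<in> A \<Longrightarrow> y \<in> B \<Longrightarrow> x \<le> y) \<Longrightarrow> crossings A B = 0"
proof -
  assume "\<And>x y. x \<in> A \<Longrightarrow> y \<in> B \<Longrightarrow> x \<le> y"
  then have "{(x, y). x \<in> A \<and> y \<in> B \<and> y < x} = {}" by (auto simp: not_less[symmetric])
  then show ?thesis by (simp only: crossings_def card.empty)
qed

section \<open>Minors of a quantum matrix over a ring\<close>

text \<open>Here \<open>z\<close> plays the role of \<open>- q\<close> and \<open>w\<close> that of its inverse.\<close>

locale quantum_matrix =
  fixes z w :: "'a::{ring,monoid_mult}"
    and a :: "'r::linorder \<Rightarrow> 'c::linorder \<Rightarrow> 'a"
  assumes z_central: "x * z = z * x"
    and w_central: "x * w = w * x"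
    and zw: "z * w = 1"
    and same_row: "k < l \<Longrightarrow> a i k * a i l = - (z * (a i l * a i k))"
    and antidiagonal: "i < j \<Longrightarrow> k < l \<Longrightarrow> a j k * a i l = a i l * a j k"
    and diagonal: "i < j \<Longrightarrow> k < l \<Longrightarrow> a i k * a j l - a j l * a i k = (w - z) * (a i l * a j k)"
begin

section \<open>Central powers of the two units\<close>

lemma z_power_central: "x * z ^ m = z ^ m * x"
  by (induction m) (simp_all add: power_commutes mult.assoc[symmetric], metis mult.assoc z_central)

lemma z_power_left: "x * (z ^ m * y) = z ^ m * (x * y)"
  by (metis mult.assoc z_power_central)

lemma w_power_central: "x * w ^ m = w ^ m * x"
  by (induction m) (simp_all add: power_commutes mult.assoc[symmetric], metis mult.assoc w_central)

lemma w_power_left: "x * (w ^ m * y) = w ^ m * (x * y)"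
  by (metis mult.assoc w_power_central)

lemma z_left: "x * (z * y) = z * (x * y)"
  by (metis mult.assoc z_central)

lemma zw_left [simp]: "z * (w * x) = x" "w * (z * x) = x"
  by (metis mult.assoc mult_1 w_central zw)+

lemma zw_power: "z ^ m * (w ^ m * x) = x"
  by (induction m arbitrary: x) (simp_all add: power_Suc2 mult.assoc del: power_Suc, simp add: w_power_left power_commutes)

lemma wz_power: "w ^ m * (z ^ m * x) = x"
  by (metis zw_power z_power_left)

text \<open>\<open>minor is S\<close> is the coefficient of the ordered monomial \<open>x\<^sub>S\<close> in the product of the forms
  \<open>\<Sum>j. a i j x\<^sub>j\<close>, \<open>i\<close> running through \<open>is\<close>, where \<open>x\<^sub>l x\<^sub>k = z x\<^sub>k x\<^sub>l\<close> for \<open>k < l\<close> and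
  \<open>x\<^sub>k x\<^sub>k = 0\<close>.\<close>

fun minor :: "'r list \<Rightarrow> 'c set \<Rightarrow> 'a" where
  "minor [] S = (if S = {} then 1 else 0)"
| "minor (i # is) S = (\<Sum>j\<in>S. z ^ crossings {j} (S - {j}) * (a i j * minor is (S - {j})))"

text \<open>Only instances with a matrix entry, a minor or a single \<open>z\<close> as the moving
  factor: with an arbitrary factor, rewriting would exchange powers of \<open>z\<close> for
  ever.\<close>

lemmas z_power_out = z_power_left[of "a i j" for i j] z_power_left[of "minor is S" for "is" S]
  z_power_left[of z, symmetric] z_left[of "a i j" for i j] z_left[of "minor is S" for "is" S]

section \<open>Quantum Laplace expansion by rows\<close>

text \<open>Every row uses up exactly one column. Later sums can therefore run over all subsets of
  the columns, whatever their size.\<close>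

lemma minor_eq_0: "finite S \<Longrightarrow> card S \<noteq> length is \<Longrightarrow> minor is S = 0"
proof (induction "is" arbitrary: S)
  case (Cons i "is")
  have "minor is (S - {j}) = 0" if "j \<in> S" for j
    using that Cons.prems by (intro Cons.IH) (auto simp: card_Suc_Diff1[symmetric] simp del: card_Diff_insert)
  then show ?case by simp
qed auto

text \<open>The product of the forms is cut in two, and the monomials \<open>x_A\<close> and
  \<open>x_(S - A)\<close> of the halves are merged into \<open>x_S\<close>. In the induction, the
  column \<open>j\<close> taken by the first row joins the columns \<open>A\<close> of the other
  rows in the first half.\<close>

lemma minor_append:
  "finite S \<Longrightarrow> minor (is @ ks) S =
    (\<Sum>A\<in>Pow S. z ^ crossings A (S - A) * (minor is A * minor ks (S - A)))"
proof (induction "is" arbitrary: S)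
  case Nil
  have "(\<Sum>A\<in>Pow S. z ^ crossings A (S - A) * (minor [] A * minor ks (S - A))) =
    (\<Sum>A\<in>Pow S. if A = {} then minor ks S else 0)"
    by (intro sum.cong) auto
  also have "\<dots> = minor ks S" using Nil by (subst sum.delta) auto
  finally show ?case by simp
next
  case (Cons i "is")
  let ?t = "\<lambda>A j. z ^ (crossings A (S - A) + crossings {j} (A - {j})) *
    (a i j * (minor is (A - {j}) * minor ks (S - A)))"
  have "minor ((i # is) @ ks) S = (\<Sum>j\<in>S. \<Sum>A\<in>Pow (S - {j}).
      z ^ (crossings {j} (S - {j}) + crossings A (S - {j} - A)) *
      (a i j * (minor is A * minor ks (S - {j} - A))))"
    using Cons by (simp add: sum_distrib_left z_power_out power_add mult.assoc)
  also have "\<dots> = (\<Sum>(j, A)\<in>Sigma S (\<lambda>j. Pow (S - {j})). z ^ (crossings {j} (S - {j}) + crossings A (S - {j} - A)) *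
      (a i j * (minor is A * minor ks (S - {j} - A))))"
    using Cons.prems by (intro sum.Sigma) auto
  also have "\<dots> = (\<Sum>(A, j)\<in>Sigma (Pow S) (\<lambda>A. A). ?t A j)"
  proof (rule sum.reindex_bij_witness[where i = "\<lambda>(A, j). (j, A - {j})" and j = "\<lambda>(j, A). (insert j A, j)"], goal_cases)
    \<comment> \<open>Both exponents count the crossings of \<open>j\<close> with \<open>A\<close>,
      of \<open>j\<close> with the remaining columns, and of \<open>A\<close> with the remaining
      columns.\<close>
    case (5 p)
    obtain j A where p: "p = (j, A)" by force
    have j: "j \<in> S" "A \<subseteq> S - {j}" using 5 p by auto
    have fin: "finite A" "finite (S - insert j A)" using Cons.prems j by (auto intro: finite_subset)
    have "crossings (insert j A) (S - insert j A) =
      crossings {j} (S - insert j A) + crossings A (S - insert j A)"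
      using crossings_Un_left[of "{j}" A "S - insert j A"] fin j by auto
    moreover have "crossings {j} (S - {j}) = crossings {j} A + crossings {j} (S - insert j A)"
    proof -
      have "S - {j} = A \<union> (S - insert j A)" using j by auto
      then show ?thesis using crossings_Un_right[of "{j}" A "S - insert j A"] fin by auto
    qed
    moreover have "insert j A - {j} = A" "S - {j} - A = S - insert j A" using j by auto
    ultimately show ?case by (simp add: p ac_simps)
  qed auto
  also have "\<dots> = (\<Sum>A\<in>Pow S. \<Sum>j\<in>A. ?t A j)"
    using Cons.prems by (intro sum.Sigma[symmetric]) (auto intro: finite_subset)
  also have "\<dots> = (\<Sum>A\<in>Pow S. z ^ crossings A (S - A) * (minor (i # is) A * minor ks (S - A)))"
    by (intro sum.cong) (simp_all add: sum_distrib_left sum_distrib_right power_add mult.assoc)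
  finally show ?case .
qed

section \<open>Exchange and repetition of rows\<close>

text \<open>The two terms in which the first two rows share the columns \<open>j < k\<close> are put
  together; the reversed order has one more crossing, hence the factor \<open>z\<close>. Row
  exchanges can then be checked on blocks with two rows and two columns.\<close>

lemma minor_two_rows:
  assumes "finite S"
  shows "minor (i # i' # is) S = (\<Sum>(j, k)\<in>{(j, k). j \<in> S \<and> k \<in> S \<and> j < k}.
    z ^ crossings {j, k} (S - {j, k}) *
      ((a i j * a i' k + z * (a i k * a i' j)) * minor is (S - {j, k})))"
proof -
  let ?P = "{(j, k). j \<in> S \<and> k \<in> S \<and> j < k}" and ?P' = "{(k, j). j \<in> S \<and> k \<in> S \<and> j < k}"
  let ?f = "\<lambda>(j, k). z ^ (crossings {j} (S - {j}) + crossings {k} (S - {j, k})) *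
     (a i j * (a i' k * minor is (S - {j, k})))"
  have fin: "finite ?P" "finite ?P'"
    by (rule finite_subset[of _ "S \<times> S"]; use assms in auto)+
  have cross: "crossings {j} (S - {j}) + crossings {k} (S - {j, k}) =
      crossings {j, k} (S - {j, k}) + (if k < j then 1 else 0)"
    if "j \<in> S" "k \<in> S" "j \<noteq> k" for j k
  proof -
    have "S - {j} = {k} \<union> (S - {j, k})" using that by auto
    then have "crossings {j} (S - {j}) = (if k < j then 1 else 0) + crossings {j} (S - {j, k})"
      using crossings_Un_right[of "{j}" "{k}" "S - {j, k}"] assms by auto
    moreover have "crossings {j, k} (S - {j, k}) = crossings {j} (S - {j, k}) + crossings {k} (S - {j, k})"
      using crossings_Un_left[of "{j}" "{k}" "S - {j, k}"] assms that by (simp add: insert_commute)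
    ultimately show ?thesis by simp
  qed
  have "minor (i # i' # is) S = (\<Sum>j\<in>S. \<Sum>k\<in>S - {j}. ?f (j, k))"
    by (simp add: sum_distrib_left z_power_out power_add mult.assoc Diff_insert[symmetric] insert_commute)
  also have "\<dots> = sum ?f (Sigma S (\<lambda>j. S - {j}))"
    using assms by (subst sum.Sigma) auto
  also have "Sigma S (\<lambda>j. S - {j}) = ?P \<union> ?P'" by auto
  also have "sum ?f \<dots> = sum ?f ?P + sum ?f ?P'"
    by (rule sum.union_disjoint[OF fin]) auto
  also have "sum ?f ?P' = (\<Sum>(j, k)\<in>?P. ?f (k, j))"
    by (rule sum.reindex_bij_witness[where i = prod.swap and j = prod.swap]) auto
  also have "sum ?f ?P + (\<Sum>(j, k)\<in>?P. ?f (k, j)) = (\<Sum>(j, k)\<in>?P. ?f (j, k) + ?f (k, j))"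
    by (simp add: sum.distrib[symmetric] split_beta)
  also have "\<dots> = (\<Sum>(j, k)\<in>?P. z ^ crossings {j, k} (S - {j, k}) *
      ((a i j * a i' k + z * (a i k * a i' j)) * minor is (S - {j, k})))"
  proof (rule sum.cong[OF refl])
    fix p assume "p \<in> ?P"
    then obtain j k where p: "p = (j, k)" "j \<in> S" "k \<in> S" "j < k" by auto
    show "(case p of (j, k) \<Rightarrow> ?f (j, k) + ?f (k, j)) = (case p of (j, k) \<Rightarrow>
        z ^ crossings {j, k} (S - {j, k}) *
          ((a i j * a i' k + z * (a i k * a i' j)) * minor is (S - {j, k})))"
      using p cross[of j k] cross[of k j] less_imp_neq[OF p(4)] less_not_sym[OF p(4)]
      by (simp add: insert_commute[of k j] distrib_left distrib_right mult.assoc power_commutes)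
        (simp only: mult.assoc[symmetric] power_commutes)
  qed
  finally show ?thesis .
qed

text \<open>For equal rows each bracket in \<open>minor_two_rows\<close> vanishes by
  \<open>same_row\<close>.\<close>

lemma minor_equal_rows: "finite S \<Longrightarrow> minor (i # i # is) S = 0"
  by (subst minor_two_rows) (auto intro!: sum.neutral simp: same_row)

text \<open>By \<open>minor_two_rows\<close> only the brackets have to be compared. Multiplied by
  \<open>z\<close>, the relation \<open>diagonal\<close> has the coefficient
  \<open>z * (w - z) = 1 - z * z\<close>, and its first part cancels by
  \<open>antidiagonal\<close>.\<close>

lemma minor_swap_rows:
  assumes "finite S" "i < i'"
  shows "minor (i' # i # is) S = z * minor (i # i' # is) S"
proof -
  have "a i' j * a i k + z * (a i' k * a i j) = z * (a i j * a i' k + z * (a i k * a i' j))"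
    if "j < k" for j k
  proof -
    have "a i' k * a i j = a i j * a i' k - (w - z) * (a i k * a i' j)"
      using diagonal[OF assms(2) that] by (simp add: algebra_simps)
    then have "z * (a i' k * a i j) = z * (a i j * a i' k) - a i k * a i' j + z * (z * (a i k * a i' j))"
      by (simp add: right_diff_distrib left_diff_distrib)
    then show ?thesis
      using antidiagonal[OF assms(2) that] by (simp add: distrib_left)
  qed
  then show ?thesis
    using assms(1)
    by (auto simp: minor_two_rows sum_distrib_left z_power_out mult.assoc simp del: minor.simps
        intro!: sum.cong)
qed

lemma minor_swap_rows_append:
  assumes "finite S" "i < i'"
  shows "minor (us @ i' # i # is) S = z * minor (us @ i # i' # is) S"
  using assms(1)
proof (induction us arbitrary: S)
  case Nil
  then show ?case using minor_swap_rows assms(2) by (simp del: minor.simps)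
next
  case (Cons u us)
  then show ?case by (simp add: sum_distrib_left z_power_out cong: sum.cong)
qed

text \<open>The left copy of \<open>x\<close> is moved to the right, one row at a time, until both
  copies are adjacent. Each exchange changes the minor by a unit only; where the factor
  \<open>z\<close> is on the wrong side, it is removed by \<open>w\<close>.\<close>

lemma minor_repeated_row:
  assumes "finite S"
  shows "minor (us @ x # ys @ x # zs) S = 0"
proof (induction ys arbitrary: us)
  case Nil
  have "minor (x # x # zs) (S - A) = 0" for A
    using assms by (intro minor_equal_rows) auto
  then show ?case by (simp add: minor_append assms del: minor.simps)
next
  case (Cons y ys)
  have 0: "minor (us @ y # x # ys @ x # zs) S = 0" using Cons[of "us @ [y]"] by simp
  consider "x < y" | "y < x" | "x = y" by fastforce
  then show ?case
  proof cases
    case 1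
    then have "z * minor (us @ x # y # ys @ x # zs) S = 0"
      using minor_swap_rows_append[OF assms] 0 by metis
    then have "w * (z * minor (us @ x # y # ys @ x # zs) S) = 0" by simp
    then show ?thesis by simp
  next
    case 2
    then show ?thesis using minor_swap_rows_append[OF assms 2] 0 by simp
  next
    case 3
    then show ?thesis using 0 by simp
  qed
qed

lemma minor_not_distinct: "finite S \<Longrightarrow> \<not> distinct is \<Longrightarrow> minor is S = 0"
  using not_distinct_decomp[of "is"] by (auto simp: minor_repeated_row)

text \<open>One factor \<open>z\<close> for each larger row that \<open>x\<close> passes. This sorts
  the rows of the extra terms that arise when column entries are collected on the right.\<close>

lemma minor_move_last:
  assumes "finite S"
  shows "\<forall>v\<in>set vs. x < v \<Longrightarrow> minor (us @ vs @ [x]) S = z ^ length vs * minor (us @ x # vs) S"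
proof (induction vs arbitrary: us)
  case (Cons v vs)
  have "minor (us @ (v # vs) @ [x]) S = z ^ length vs * minor (us @ v # x # vs) S"
    using Cons(1)[of "us @ [v]"] Cons(2) by simp
  also have "minor (us @ v # x # vs) S = z * minor (us @ x # v # vs) S"
    using Cons(2) by (intro minor_swap_rows_append assms) auto
  finally show ?case by (simp add: power_commutes mult.assoc[symmetric])
qed simp

section \<open>Expansion along the first column\<close>

text \<open>The mirror image of the recursion for \<open>minor\<close>: in
  \<open>minor_append\<close> with a single last row, only complements of one column
  contribute.\<close>

lemma minor_snoc:
  assumes "finite S"
  shows "minor (is @ [m]) S =
    (\<Sum>j\<in>S. z ^ crossings (S - {j}) {j} * (minor is (S - {j}) * a m j))"
proof -
  let ?f = "\<lambda>A. z ^ crossings A (S - A) * (minor is A * minor [m] (S - A))"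
  have "minor (is @ [m]) S = sum ?f (Pow S)"
    using assms by (rule minor_append)
  also have "\<dots> = sum ?f ((\<lambda>j. S - {j}) ` S)"
  proof (rule sum.mono_neutral_right)
    show "\<forall>A\<in>Pow S - (\<lambda>j. S - {j}) ` S. ?f A = 0"
    proof
      fix A assume A: "A \<in> Pow S - (\<lambda>j. S - {j}) ` S"
      have "card (S - A) \<noteq> 1"
      proof
        assume "card (S - A) = 1"
        then obtain j where "S - A = {j}" by (meson card_1_singletonE)
        then have "A = S - {j}" "j \<in> S" using A by auto
        then show False using A by auto
      qed
      then have "minor [m] (S - A) = 0"
        using assms by (intro minor_eq_0) auto
      then show "?f A = 0" by (simp del: minor.simps)
    qed
  qed (use assms in auto)
  also have "\<dots> = (\<Sum>j\<in>S. ?f (S - {j}))"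
    by (subst sum.reindex) (auto simp: inj_on_def)
  also have "\<dots> = (\<Sum>j\<in>S. z ^ crossings (S - {j}) {j} * (minor is (S - {j}) * a m j))"
  proof (rule sum.cong[OF refl])
    fix j assume "j \<in> S"
    then have "S - (S - {j}) = {j}" by auto
    then show "?f (S - {j}) = z ^ crossings (S - {j}) {j} * (minor is (S - {j}) * a m j)"
      by simp
  qed
  finally show ?thesis .
qed

text \<open>The first row either takes the column \<open>d\<close> or a column \<open>j > d\<close>.
  In the second case its entry commutes with the entry of a later row in column \<open>d\<close>, by
  \<open>antidiagonal\<close>, and so the column entry comes to the front. Each row passed in this
  way adds one crossing with \<open>d\<close>, which gives \<open>z ^ s\<close>.\<close>

lemma minor_first_column:
  assumes "finite S" "d \<in> S" "\<forall>k\<in>S. d \<le> k" "sorted_wrt (<) is"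
  shows "minor is S = (\<Sum>s<length is. z ^ s *
    (a (is ! s) d * minor (take s is @ drop (Suc s) is) (S - {d})))"
  using assms
proof (induction "is" arbitrary: S)
  case (Cons i "is")
  let ?T = "S - {d}" and ?rm = "\<lambda>s. take s is @ drop (Suc s) is"
  \<comment> \<open>The additional crossing is the one of \<open>j\<close> with
    \<open>d\<close>.\<close>
  have cr: "crossings {j} (S - {j}) = Suc (crossings {j} (?T - {j}))" if "j \<in> ?T" for j
  proof -
    have "S - {j} = {d} \<union> (?T - {j})" using that Cons.prems by auto
    moreover have "d < j" using that Cons.prems by auto
    ultimately show ?thesis
      using crossings_Un_right[of "{j}" "{d}" "?T - {j}"] Cons.prems by auto
  qed
  have "minor (i # is) S = z ^ crossings {d} ?T * (a i d * minor is ?T) +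
      (\<Sum>j\<in>?T. z ^ crossings {j} (S - {j}) * (a i j * minor is (S - {j})))"
    using Cons.prems by (simp add: sum.remove[of S d])
  also have "crossings {d} ?T = 0" using Cons.prems by (intro crossings_eq_0) auto
  also have "(\<Sum>j\<in>?T. z ^ crossings {j} (S - {j}) * (a i j * minor is (S - {j}))) =
    (\<Sum>j\<in>?T. \<Sum>s<length is. z ^ Suc s * (a (is ! s) d *
       (z ^ crossings {j} (?T - {j}) * (a i j * minor (?rm s) (?T - {j})))))"
  proof (rule sum.cong[OF refl])
    fix j assume j: "j \<in> ?T"
    have "d < j" using j Cons.prems by auto
    have IH: "minor is (S - {j}) =
        (\<Sum>s<length is. z ^ s * (a (is ! s) d * minor (?rm s) (S - {j} - {d})))"
      using j Cons.prems by (intro Cons.IH) auto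
    have "a i j * (a (is ! s) d * x) = a (is ! s) d * (a i j * x)" if "s < length is" for s x
      using antidiagonal[of i "is ! s" d j] \<open>d < j\<close> that Cons.prems
      by (simp add: mult.assoc[symmetric])
    moreover have "S - {j} - {d} = ?T - {j}" by auto
    ultimately show "z ^ crossings {j} (S - {j}) * (a i j * minor is (S - {j})) =
      (\<Sum>s<length is. z ^ Suc s * (a (is ! s) d *
       (z ^ crossings {j} (?T - {j}) * (a i j * minor (?rm s) (?T - {j})))))"
      unfolding IH cr[OF j]
      by (auto simp: sum_distrib_left z_power_out mult.assoc z_power_left[of "z ^ s" for s] intro!: sum.cong)
  qed
  also have "\<dots> = (\<Sum>s<length is. z ^ Suc s * (a (is ! s) d * minor (i # ?rm s) ?T))"
    by (subst sum.swap) (simp add: sum_distrib_left)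
  finally show ?case by (simp add: sum.lessThan_Suc_shift del: sum.lessThan_Suc)
qed auto

text \<open>The telescoping factorisation of \<open>w ^ L - z ^ L\<close>. It evaluates the total
  coefficient of the terms ending in \<open>a m d\<close> when \<open>m\<close> is the last row and
  column entries are moved to the right.\<close>

lemma geometric_zw: "z ^ L + (\<Sum>s<L. w ^ s * ((w - z) * z ^ (L - 1 - s))) = w ^ L"
proof (induction L)
  case (Suc L)
  have "(\<Sum>s<L. w ^ s * ((w - z) * z ^ (L - s))) = (\<Sum>s<L. w ^ s * ((w - z) * z ^ (L - 1 - s))) * z"
    unfolding sum_distrib_right
  proof (rule sum.cong[OF refl])
    fix s assume "s \<in> {..<L}"
    then have "L - s = Suc (L - 1 - s)" by auto
    then have "z ^ (L - s) = z ^ (L - 1 - s) * z" by (simp only: power_Suc2)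
    then show "w ^ s * ((w - z) * z ^ (L - s)) = w ^ s * ((w - z) * z ^ (L - 1 - s)) * z"
      by (simp add: mult.assoc)
  qed
  then have "z ^ Suc L + (\<Sum>s<Suc L. w ^ s * ((w - z) * z ^ (Suc L - 1 - s))) =
    (z ^ L + (\<Sum>s<L. w ^ s * ((w - z) * z ^ (L - 1 - s)))) * z + w ^ L * (w - z)"
    by (simp add: distrib_right power_commutes)
  also have "\<dots> = w ^ L * z + w ^ L * (w - z)" by (simp only: Suc)
  finally show ?case by (simp add: right_diff_distrib power_commutes)
qed simp

text \<open>Moving \<open>a m j\<close> past the first-column entry of the row \<open>is ! s\<close> produces an extra term that
  contains the row \<open>is ! s\<close> in place of \<open>m\<close>; sorting the rows of these terms makes their coefficients
  add up to a geometric sum.\<close>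

lemma minor_first_column_right:
  assumes "finite S" "d \<in> S" "\<forall>k\<in>S. d \<le> k" "sorted_wrt (<) is"
  shows "minor is S = (\<Sum>s<length is. w ^ s *
    (minor (take s is @ drop (Suc s) is) (S - {d}) * a (is ! s) d))"
  using assms
proof (induction "is" arbitrary: S rule: rev_induct)
  case (snoc m "is")
  let ?T = "S - {d}" and ?rm = "\<lambda>s. take s is @ drop (Suc s) is" and ?L = "length is"
  have rm_snoc: "take s (is @ [m]) @ drop (Suc s) (is @ [m]) = ?rm s @ [m]" if "s < ?L" for s
    using that by simp
  show ?case
  proof (cases "card S = Suc ?L")
    \<comment> \<open>Both sides vanish by \<open>minor_eq_0\<close>. The case is split off because
      below \<open>?L\<close> has to be the number of columns other than \<open>d\<close>.\<close>
    case False
    then have "card ?T \<noteq> ?L" using snoc.prems by (simp add: card_Diff_singleton_if)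
      (metis Suc_pred card_gt_0_iff empty_iff)
    then have "minor (take s (is @ [m]) @ drop (Suc s) (is @ [m])) ?T = 0" if "s < Suc ?L" for s
      using that snoc.prems by (intro minor_eq_0) auto
    then show ?thesis using False snoc.prems minor_eq_0[of S "is @ [m]"] by simp
  next
    case True
    have lt: "is ! s < m" if "s < ?L" for s
      using that snoc.prems by (auto simp: sorted_wrt_append)
    have d_lt: "d < j" if "j \<in> ?T" for j using that snoc.prems by auto
    \<comment> \<open>The column \<open>d\<close> is smaller than the \<open>?L\<close> other
      columns, so taking it last costs \<open>?L\<close> crossings.\<close>
    have crd: "crossings ?T {d} = ?L"
    proof -
      have "crossings {d} ?T = 0" using snoc.prems by (intro crossings_eq_0) auto
      then show ?thesis using crossings_swap[of ?T "{d}"] snoc.prems True by simp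
    qed
    have cr: "crossings (S - {j}) {j} = crossings (?T - {j}) {j}" if "j \<in> ?T" for j
    proof -
      have "S - {j} = {d} \<union> (?T - {j})" using that snoc.prems by auto
      then show ?thesis
        using crossings_Un_left[of "{d}" "?T - {j}" "{j}"] snoc.prems d_lt[OF that] by auto
    qed
    let ?A = "\<lambda>s j. w ^ s * (z ^ crossings (?T - {j}) {j} * (minor (?rm s) (?T - {j}) * a m j) * a (is ! s) d)"
    let ?B = "\<lambda>s j. w ^ s * ((w - z) * (z ^ crossings (?T - {j}) {j} * (minor (?rm s) (?T - {j}) * a (is ! s) j) * a m d))"
    have "minor (is @ [m]) S = z ^ ?L * (minor is ?T * a m d) +
        (\<Sum>j\<in>?T. z ^ crossings (S - {j}) {j} * (minor is (S - {j}) * a m j))"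
      using snoc.prems by (simp add: minor_snoc sum.remove[of S d] crd)
    also have "(\<Sum>j\<in>?T. z ^ crossings (S - {j}) {j} * (minor is (S - {j}) * a m j)) =
      (\<Sum>j\<in>?T. \<Sum>s<?L. ?A s j + ?B s j)"
    proof (rule sum.cong[OF refl])
      fix j assume j: "j \<in> ?T"
      have IH: "minor is (S - {j}) =
          (\<Sum>s<?L. w ^ s * (minor (?rm s) (S - {j} - {d}) * a (is ! s) d))"
        using j snoc.prems by (intro snoc.IH) (auto simp: sorted_wrt_append)
      have "S - {j} - {d} = ?T - {j}" by auto
      moreover have "z ^ c * (w ^ s * (x * a (is ! s) d) * a m j) =
          w ^ s * (z ^ c * (x * a m j) * a (is ! s) d) +
          w ^ s * ((w - z) * (z ^ c * (x * a (is ! s) j) * a m d))" if "s < ?L" for s x c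
      proof -
        have "a (is ! s) d * a m j = a m j * a (is ! s) d + (w - z) * (a (is ! s) j * a m d)"
          using diagonal[OF lt[OF that] d_lt[OF j]] by (simp add: algebra_simps)
        moreover have "y * (w - z) = (w - z) * y" for y
          by (simp add: left_diff_distrib right_diff_distrib z_central[of y] w_central[of y])
        then have "y * ((w - z) * v) = (w - z) * (y * v)" for y v
          by (metis mult.assoc)
        ultimately show ?thesis
          by (simp add: mult.assoc distrib_left w_power_left[of "z ^ c"])
      qed
      ultimately show "z ^ crossings (S - {j}) {j} * (minor is (S - {j}) * a m j) =
          (\<Sum>s<?L. ?A s j + ?B s j)"
        unfolding IH cr[OF j] by (simp add: sum_distrib_left sum_distrib_right)
    qed
    also have "\<dots> = (\<Sum>s<?L. w ^ s * (minor (?rm s @ [m]) ?T * a (is ! s) d)) +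
        (\<Sum>s<?L. w ^ s * ((w - z) * (minor (?rm s @ [is ! s]) ?T * a m d)))"
      using snoc.prems by (subst sum.swap) (simp add: sum.distrib sum_distrib_left sum_distrib_right minor_snoc
          del: append_assoc)
    also have "(\<Sum>s<?L. w ^ s * ((w - z) * (minor (?rm s @ [is ! s]) ?T * a m d))) =
        (\<Sum>s<?L. w ^ s * ((w - z) * z ^ (?L - 1 - s))) * (minor is ?T * a m d)"
    proof -
      \<comment> \<open>The rows after position \<open>s\<close> are larger than
        \<open>is ! s\<close>; moving \<open>is ! s\<close> back over these
        \<open>?L - 1 - s\<close> rows restores \<open>is\<close>.\<close>
      have "minor (?rm s @ [is ! s]) ?T = z ^ (?L - 1 - s) * minor is ?T" if "s < ?L" for s
      proof -
        have "\<forall>v\<in>set (drop (Suc s) is). is ! s < v"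
          using snoc.prems that by (auto simp: sorted_wrt_append in_set_conv_nth sorted_wrt_nth_less)
        then show ?thesis
          using minor_move_last[of ?T "drop (Suc s) is" "is ! s" "take s is"] snoc.prems that
          by (simp add: id_take_nth_drop[symmetric])
      qed
      then show ?thesis by (simp add: sum_distrib_right mult.assoc)
    qed
    finally have "minor (is @ [m]) S = (z ^ ?L + (\<Sum>s<?L. w ^ s * ((w - z) * z ^ (?L - 1 - s)))) *
        (minor is ?T * a m d) + (\<Sum>s<?L. w ^ s * (minor (?rm s @ [m]) ?T * a (is ! s) d))"
      by (simp add: distrib_right ac_simps)
    then show ?thesis
      \<comment> \<open>The geometric sum becomes \<open>w ^ ?L\<close>, the coefficient of the term
        that removes the last row \<open>m\<close>; the other sum supplies the terms with
        \<open>s < ?L\<close>.\<close>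
      unfolding geometric_zw by (simp add: rm_snoc nth_append add.commute)
  qed
qed auto

section \<open>The two identities over a ring\<close>

text \<open>Expanding along the columns in \<open>D\<close> reduces both identities to \<open>D = {}\<close>, where the sum is, up
  to a unit, the minor with rows \<open>is @ ks\<close> or \<open>ks @ is\<close>, which has a repeated row.\<close>

theorem plucker_left:
  assumes "finite D" "finite C" "\<forall>d\<in>D. \<forall>c\<in>C. d < c"
    and "sorted_wrt (<) is" "set is \<subseteq> set ks" "card D < length is"
  shows "(\<Sum>A\<in>Pow C. z ^ crossings A (C - A) * (minor is (D \<union> A) * minor ks (C - A))) = 0"
  using assms(1,3-)
proof (induction "card D" arbitrary: D "is")
  case 0
  \<comment> \<open>With \<open>D\<close> empty, the bound on \<open>card D\<close> leaves a row in
    \<open>is\<close>, and this row occurs in \<open>ks\<close> as well.\<close>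
  then have "\<not> distinct (is @ ks)" "D = {}" by (cases "is"; auto)+
  then show ?case using minor_not_distinct[of C "is @ ks"] assms(2) by (simp add: minor_append)
next
  case (Suc m)
  define d where "d = Min D"
  have D: "D \<noteq> {}" using Suc.hyps by auto
  have d: "d \<in> D" "\<forall>k\<in>D. d \<le> k" using D Suc.prems by (auto simp: d_def)
  let ?rm = "\<lambda>s. take s is @ drop (Suc s) is"
  \<comment> \<open>Since \<open>d\<close> is smaller than all of \<open>C\<close>, the expansion
    has the same form for every \<open>A\<close>, and the sum over \<open>A\<close> can be moved
    inside.\<close>
  have "minor is (D \<union> A) = (\<Sum>s<length is. z ^ s *
      (a (is ! s) d * minor (?rm s) ((D - {d}) \<union> A)))" if "A \<subseteq> C" for A
  proof -
    have "D \<union> A - {d} = (D - {d}) \<union> A" using that d Suc.prems by auto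
    moreover have "\<forall>k\<in>D \<union> A. d \<le> k" using that d Suc.prems(2) by (blast intro: less_imp_le)
    moreover have "finite (D \<union> A)" using that Suc.prems(1) assms(2) by (auto intro: finite_subset)
    ultimately show ?thesis
      using minor_first_column[of "D \<union> A" d "is"] d Suc.prems(3) by simp
  qed
  note expand = this
  have "(\<Sum>A\<in>Pow C. z ^ crossings A (C - A) * (minor is (D \<union> A) * minor ks (C - A))) =
    (\<Sum>A\<in>Pow C. \<Sum>s<length is. z ^ s * (a (is ! s) d *
      (z ^ crossings A (C - A) * (minor (?rm s) ((D - {d}) \<union> A) * minor ks (C - A)))))"
  proof (rule sum.cong[OF refl], drule PowD)
    fix A assume "A \<subseteq> C"
    show "z ^ crossings A (C - A) * (minor is (D \<union> A) * minor ks (C - A)) =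
      (\<Sum>s<length is. z ^ s * (a (is ! s) d *
        (z ^ crossings A (C - A) * (minor (?rm s) ((D - {d}) \<union> A) * minor ks (C - A)))))"
      unfolding expand[OF \<open>A \<subseteq> C\<close>] sum_distrib_left sum_distrib_right
      by (rule sum.cong[OF refl], simp only: mult.assoc z_power_left[of "a i j" for i j])
        (rule z_power_left)
  qed
  also have "\<dots> = (\<Sum>s<length is. z ^ s * (a (is ! s) d * (\<Sum>A\<in>Pow C.
      z ^ crossings A (C - A) * (minor (?rm s) ((D - {d}) \<union> A) * minor ks (C - A)))))"
    by (subst sum.swap) (simp add: sum_distrib_left)
  also have "\<dots> = 0"
  proof (rule sum.neutral, rule ballI)
    fix s assume s: "s \<in> {..<length is}"
    \<comment> \<open>Removing one row and the column \<open>d\<close> lowers both sides of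
      \<open>card D < length is\<close> by one.\<close>
    have "(\<Sum>A\<in>Pow C. z ^ crossings A (C - A) *
        (minor (?rm s) ((D - {d}) \<union> A) * minor ks (C - A))) = 0"
    proof (rule Suc.hyps(1))
      have "sorted_wrt (<) (take s is @ is ! s # drop (Suc s) is)"
        using s Suc.prems(3) by (simp add: id_take_nth_drop[symmetric])
      then show "sorted_wrt (<) (?rm s)" by (auto simp: sorted_wrt_append)
      show "set (?rm s) \<subseteq> set ks"
        using Suc.prems(4) set_take_subset[of s "is"] set_drop_subset[of "Suc s" "is"] by auto
    qed (use Suc s d in auto)
    then show "z ^ s * (a (is ! s) d * (\<Sum>A\<in>Pow C. z ^ crossings A (C - A) *
        (minor (?rm s) ((D - {d}) \<union> A) * minor ks (C - A)))) = 0" by simp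
  qed
  finally show ?case .
qed

theorem plucker_right:
  assumes "finite D" "finite C" "\<forall>d\<in>D. \<forall>c\<in>C. d < c"
    and "sorted_wrt (<) is" "set is \<subseteq> set ks" "card D < length is"
  shows "(\<Sum>A\<in>Pow C. w ^ crossings A (C - A) * (minor ks (C - A) * minor is (D \<union> A))) = 0"
  using assms(1,3-)
proof (induction "card D" arbitrary: D "is")
  case 0
  let ?c = "length is * length ks"
  have D: "D = {}" and nd: "\<not> distinct (ks @ is)" using 0 by (cases "is"; auto)+
  \<comment> \<open>By \<open>crossings_swap\<close> the two exponents add up to the constant
    \<open>?c\<close> whenever the sizes fit; otherwise both sides are zero. So the sum is a unit
    times a Laplace expansion with \<open>ks\<close> in front.\<close>
  have "w ^ crossings A (C - A) * (minor ks (C - A) * minor is A) =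
      w ^ ?c * (z ^ crossings (C - A) A * (minor ks (C - A) * minor is A))" if "A \<subseteq> C" for A
  proof (cases "card A = length is \<and> card (C - A) = length ks")
    case True
    have "finite A" using that assms(2) by (rule finite_subset)
    then have "?c = crossings A (C - A) + crossings (C - A) A"
      using crossings_swap[of A "C - A"] True assms(2) by auto
    then show ?thesis by (simp add: power_add mult.assoc wz_power)
  next
    case False
    then have "minor is A = 0 \<or> minor ks (C - A) = 0"
      using that assms(2) minor_eq_0 finite_subset by blast
    then show ?thesis by auto
  qed
  then have "(\<Sum>A\<in>Pow C. w ^ crossings A (C - A) * (minor ks (C - A) * minor is A)) =
      w ^ ?c * (\<Sum>A\<in>Pow C. z ^ crossings (C - A) A * (minor ks (C - A) * minor is A))"
    by (simp add: sum_distrib_left)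
  also have "(\<Sum>A\<in>Pow C. z ^ crossings (C - A) A * (minor ks (C - A) * minor is A)) =
      minor (ks @ is) C"
    unfolding minor_append[OF assms(2)]
    by (rule sum.reindex_bij_witness[where i = "\<lambda>A. C - A" and j = "\<lambda>A. C - A"])
      (auto simp: double_diff)
  also have "\<dots> = 0" by (rule minor_not_distinct[OF assms(2) nd])
  finally show ?case by (simp add: D)
next
  case (Suc m)
  define d where "d = Min D"
  have D: "D \<noteq> {}" using Suc.hyps by auto
  have d: "d \<in> D" "\<forall>k\<in>D. d \<le> k" using D Suc.prems by (auto simp: d_def)
  let ?rm = "\<lambda>s. take s is @ drop (Suc s) is"
  \<comment> \<open>The column entries now stand on the right, where they can be taken out behind
    both minors.\<close>
  have "minor is (D \<union> A) = (\<Sum>s<length is. w ^ s *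
      (minor (?rm s) ((D - {d}) \<union> A) * a (is ! s) d))" if "A \<subseteq> C" for A
  proof -
    have "D \<union> A - {d} = (D - {d}) \<union> A" using that d Suc.prems by auto
    moreover have "\<forall>k\<in>D \<union> A. d \<le> k" using that d Suc.prems(2) by (blast intro: less_imp_le)
    moreover have "finite (D \<union> A)" using that Suc.prems(1) assms(2) by (auto intro: finite_subset)
    ultimately show ?thesis
      using minor_first_column_right[of "D \<union> A" d "is"] d Suc.prems(3) by simp
  qed
  note expand = this
  have "(\<Sum>A\<in>Pow C. w ^ crossings A (C - A) * (minor ks (C - A) * minor is (D \<union> A))) =
    (\<Sum>A\<in>Pow C. \<Sum>s<length is. w ^ s * ((w ^ crossings A (C - A) *
      (minor ks (C - A) * minor (?rm s) ((D - {d}) \<union> A))) * a (is ! s) d))"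
  proof (rule sum.cong[OF refl], drule PowD)
    fix A assume "A \<subseteq> C"
    show "w ^ crossings A (C - A) * (minor ks (C - A) * minor is (D \<union> A)) =
      (\<Sum>s<length is. w ^ s * ((w ^ crossings A (C - A) *
        (minor ks (C - A) * minor (?rm s) ((D - {d}) \<union> A))) * a (is ! s) d))"
      unfolding expand[OF \<open>A \<subseteq> C\<close>] sum_distrib_left sum_distrib_right
      by (rule sum.cong[OF refl], simp only: mult.assoc w_power_left[of "minor ks S" for S])
        (rule w_power_left)
  qed
  also have "\<dots> = (\<Sum>s<length is. w ^ s * ((\<Sum>A\<in>Pow C. w ^ crossings A (C - A) *
      (minor ks (C - A) * minor (?rm s) ((D - {d}) \<union> A))) * a (is ! s) d))"
    by (subst sum.swap) (simp add: sum_distrib_left sum_distrib_right)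
  also have "\<dots> = 0"
  proof (rule sum.neutral, rule ballI)
    fix s assume s: "s \<in> {..<length is}"
    have "(\<Sum>A\<in>Pow C. w ^ crossings A (C - A) *
        (minor ks (C - A) * minor (?rm s) ((D - {d}) \<union> A))) = 0"
    proof (rule Suc.hyps(1))
      have "sorted_wrt (<) (take s is @ is ! s # drop (Suc s) is)"
        using s Suc.prems(3) by (simp add: id_take_nth_drop[symmetric])
      then show "sorted_wrt (<) (?rm s)" by (auto simp: sorted_wrt_append)
      show "set (?rm s) \<subseteq> set ks"
        using Suc.prems(4) set_take_subset[of s "is"] set_drop_subset[of "Suc s" "is"] by auto
    qed (use Suc s d in auto)
    then show "w ^ s * ((\<Sum>A\<in>Pow C. w ^ crossings A (C - A) *
        (minor ks (C - A) * minor (?rm s) ((D - {d}) \<union> A))) * a (is ! s) d) = 0" by simp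
  qed
  finally show ?case .
qed

end

section \<open>Minors as sums over permutations\<close>

text \<open>The count is made on lists over any linear order so that it can follow the recursion of
  \<open>minor\<close> along its rows.\<close>

definition list_inversions :: "'a::linorder list \<Rightarrow> nat" where
  "list_inversions xs = card {(i, j). i < j \<and> j < length xs \<and> xs ! j < xs ! i}"

lemma list_inversions_Nil [simp]: "list_inversions [] = 0"
  by (simp add: list_inversions_def)

text \<open>The inversions that involve the head are its crossings with the tail; as the entries are
  distinct, counting positions and counting entries agree.\<close>

lemma list_inversions_Cons:
  assumes "distinct (x # xs)"
  shows "list_inversions (x # xs) = crossings {x} (set xs) + list_inversions xs"
proof -
  let ?X = "{j. j < length xs \<and> xs ! j < x}"
  let ?Y = "{(i, j). i < j \<and> j < length xs \<and> xs ! j < xs ! i}"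
  have "{(i, j). i < j \<and> j < length (x # xs) \<and> (x # xs) ! j < (x # xs) ! i} =
    (\<lambda>j. (0, Suc j)) ` ?X \<union> map_prod Suc Suc ` ?Y"
    (is "?L = ?R")
  proof (rule Set.set_eqI)
    fix p show "p \<in> ?L \<longleftrightarrow> p \<in> ?R"
      by (cases p; cases "fst p"; cases "snd p") (auto simp: image_iff)
  qed
  moreover have "finite ?Y" by (rule finite_subset[of _ "{..length xs} \<times> {..length xs}"]) auto
  ultimately have "list_inversions (x # xs) = card ((\<lambda>j. (0::nat, Suc j)) ` ?X) + card (map_prod Suc Suc ` ?Y)"
    unfolding list_inversions_def by (simp only:) (intro card_Un_disjoint, auto)
  also have "card ((\<lambda>j. (0::nat, Suc j)) ` ?X) = card ((\<lambda>j. (x, xs ! j)) ` ?X)"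
    using assms by (simp add: card_image inj_on_def nth_eq_iff_index_eq)
  also have "(\<lambda>j. (x, xs ! j)) ` ?X = {(x', y). x' \<in> {x} \<and> y \<in> set xs \<and> y < x'}"
    by (auto simp: in_set_conv_nth)
  also have "card (map_prod Suc Suc ` ?Y) = list_inversions xs"
    unfolding list_inversions_def by (rule card_image) (auto simp: inj_on_def)
  finally show ?thesis by (simp add: crossings_def)
qed

lemma list_inversions_map_strict_mono:
  assumes "strict_mono_on A f" "set xs \<subseteq> A"
  shows "list_inversions (map f xs) = list_inversions xs"
  unfolding list_inversions_def
proof (rule arg_cong[where f = card], rule Collect_cong, clarsimp)
  fix i j
  have "f (xs ! j) < f (xs ! i) \<longleftrightarrow> xs ! j < xs ! i" if "i < j" "j < length xs"
    using that assms(2)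
    by (meson assms(1) less_trans nth_mem strict_mono_on_less subsetD)
  then show "(i < j \<and> j < length xs \<and> map f xs ! j < map f xs ! i) =
      (i < j \<and> j < length xs \<and> xs ! j < xs ! i)" by auto
qed

lemma list_inversions_permutation:
  "list_inversions (map \<sigma> [1..<Suc m]) = inversions m \<sigma>"
proof -
  let ?Y = "{(i, j). i < j \<and> j < m \<and> \<sigma> (Suc j) < \<sigma> (Suc i)}"
  have "{(i, j). i < j \<and> j < length (map \<sigma> [1..<Suc m]) \<and>
      map \<sigma> [1..<Suc m] ! j < map \<sigma> [1..<Suc m] ! i} = ?Y"
    by (auto simp del: upt_Suc)
  \<comment> \<open>List positions start at 0, the arguments of \<open>\<sigma>\<close> at
    1.\<close>
  moreover have "map_prod Suc Suc ` ?Y = {(i, j). 1 \<le> i \<and> i < j \<and> j \<le> m \<and> \<sigma> j < \<sigma> i}"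
    (is "?L = ?R")
  proof (rule Set.set_eqI)
    fix p show "p \<in> ?L \<longleftrightarrow> p \<in> ?R"
      by (cases p; cases "fst p"; cases "snd p") (auto simp: image_iff)
  qed
  moreover have "card (map_prod Suc Suc ` ?Y) = card ?Y"
    by (rule card_image) (auto simp: inj_on_def)
  ultimately show ?thesis by (simp only: list_inversions_def inversions_def)
qed

text \<open>A permutation can be recovered from its list because \<open>J\<close> is injective. Both
  sets have \<open>s!\<close> elements, so surjectivity follows by counting.\<close>

lemma bij_betw_permutes_permutations_of_set:
  assumes "inj_on J {1..s}"
  shows "bij_betw (\<lambda>\<tau>. map (\<lambda>k. J (\<tau> k)) [1..<Suc s]) {\<tau>. \<tau> permutes {1..s}}
    (permutations_of_set (J ` {1..s}))"
proof -
  let ?h = "\<lambda>\<tau>. map (\<lambda>k. J (\<tau> k)) [1..<Suc s]" and ?P = "{\<tau>. \<tau> permutes {1..s}}"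
  have set: "set [1..<Suc s] = {1..s}" by auto
  have inj: "inj_on ?h ?P"
  proof (rule inj_onI, rule ext)
    fix \<tau> \<tau>' k assume *: "\<tau> \<in> ?P" "\<tau>' \<in> ?P" "?h \<tau> = ?h \<tau>'"
    show "\<tau> k = \<tau>' k"
    proof (cases "k \<in> {1..s}")
      case True
      then have "J (\<tau> k) = J (\<tau>' k)" using *(3) unfolding map_eq_conv set by blast
      moreover have "\<tau> k \<in> {1..s}" "\<tau>' k \<in> {1..s}"
        using True permutes_in_image[of \<tau> "{1..s}" k] permutes_in_image[of \<tau>' "{1..s}" k] *(1,2)
        by (simp_all only: mem_Collect_eq)
      ultimately show ?thesis using assms by (meson inj_onD)
    next
      case False
      then show ?thesis using * permutes_not_in by (metis mem_Collect_eq)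
    qed
  qed
  have sub: "?h ` ?P \<subseteq> permutations_of_set (J ` {1..s})"
  proof (rule image_subsetI)
    fix \<tau> assume "\<tau> \<in> ?P"
    then have \<tau>: "\<tau> permutes {1..s}" by simp
    have "set (?h \<tau>) = J ` \<tau> ` {1..s}" unfolding set_map set by (simp add: image_image)
    then have "set (?h \<tau>) = J ` {1..s}" by (simp only: permutes_image[OF \<tau>])
    moreover have "inj_on (J \<circ> \<tau>) {1..s}"
      using assms permutes_inj_on[OF \<tau>] by (intro comp_inj_on) (simp_all only: permutes_image[OF \<tau>])
    then have "distinct (?h \<tau>)"
      unfolding distinct_map set by (simp add: o_def)
    ultimately show "?h \<tau> \<in> permutations_of_set (J ` {1..s})" by (rule permutations_of_setI)
  qed
  have "card (?h ` ?P) = card (permutations_of_set (J ` {1..s}))"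
    using card_image[OF assms] unfolding card_image[OF inj] by (simp add: card_permutations)
  then have "?h ` ?P = permutations_of_set (J ` {1..s})"
    by (intro card_subset_eq sub) auto
  then show ?thesis using inj by (simp add: bij_betw_def)
qed

context quantum_matrix
begin

text \<open>Solves the recursion: the orderings of \<open>S\<close> are grouped by their first
  entry, the column taken by the first row.\<close>

lemma minor_permutations_of_set:
  assumes "finite S" "card S = length is"
  shows "minor is S = (\<Sum>js\<in>permutations_of_set S.
    z ^ list_inversions js * prod_list (map2 a is js))"
  using assms
proof (induction "is" arbitrary: S)
  case (Cons i "is")
  let ?f = "\<lambda>js. z ^ list_inversions js * prod_list (map2 a (i # is) js)"
  have "S \<noteq> {}" using Cons.prems by auto
  have "(\<Sum>js\<in>permutations_of_set S. ?f js) = (\<Sum>j\<in>S. sum ?f ((#) j ` permutations_of_set (S - {j})))"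
    unfolding permutations_of_set_nonempty[OF \<open>S \<noteq> {}\<close>]
    using Cons.prems by (intro sum.UNION_disjoint) auto
  also have "\<dots> = minor (i # is) S"
    unfolding minor.simps
  proof (rule sum.cong[OF refl])
    fix j assume j: "j \<in> S"
    have "sum ?f ((#) j ` permutations_of_set (S - {j})) =
        (\<Sum>js\<in>permutations_of_set (S - {j}). ?f (j # js))"
      by (subst sum.reindex) auto
    also have "\<dots> = (\<Sum>js\<in>permutations_of_set (S - {j}). z ^ crossings {j} (S - {j}) *
        (a i j * (z ^ list_inversions js * prod_list (map2 a is js))))"
    proof (rule sum.cong[OF refl])
      fix js assume "js \<in> permutations_of_set (S - {j})"
      then have "set js = S - {j}" "distinct js" by (auto simp: permutations_of_set_def)
      then show "?f (j # js) = z ^ crossings {j} (S - {j}) *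
        (a i j * (z ^ list_inversions js * prod_list (map2 a is js)))"
        by (simp add: list_inversions_Cons power_add mult.assoc z_power_left[of "a i j"])
    qed
    also have "\<dots> = z ^ crossings {j} (S - {j}) * (a i j * minor is (S - {j}))"
      using j Cons.prems by (subst Cons.IH) (auto simp: sum_distrib_left)
    finally show "sum ?f ((#) j ` permutations_of_set (S - {j})) =
        z ^ crossings {j} (S - {j}) * (a i j * minor is (S - {j}))" .
  qed
  finally show ?case by simp
qed auto

end

text \<open>Links the recursive minor to the usual formula over permutations. Relabelling the
  columns by the increasing map \<open>J\<close> does not change the number of inversions.\<close>

lemma (in quantum_matrix) minor_permutes:
  fixes J :: "nat \<Rightarrow> 'c"
  assumes "strict_mono_on {1..s} J"
  shows "minor (map I [1..<Suc s]) (J ` {1..s}) = (\<Sum>\<tau> | \<tau> permutes {1..s}.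
    z ^ inversions s \<tau> * prod_list (map (\<lambda>k. a (I k) (J (\<tau> k))) [1..<Suc s]))"
proof -
  have inj: "inj_on J {1..s}" using assms by (rule strict_mono_on_imp_inj_on)
  have "minor (map I [1..<Suc s]) (J ` {1..s}) = (\<Sum>js\<in>permutations_of_set (J ` {1..s}).
      z ^ list_inversions js * prod_list (map2 a (map I [1..<Suc s]) js))"
    using inj by (intro minor_permutations_of_set) (auto simp: card_image)
  also have "\<dots> = (\<Sum>\<tau> | \<tau> permutes {1..s}.
      z ^ list_inversions (map (\<lambda>k. J (\<tau> k)) [1..<Suc s]) *
      prod_list (map2 a (map I [1..<Suc s]) (map (\<lambda>k. J (\<tau> k)) [1..<Suc s])))"
    by (rule sum.reindex_bij_betw[OF bij_betw_permutes_permutations_of_set[OF inj], symmetric])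
  also have "\<dots> = (\<Sum>\<tau> | \<tau> permutes {1..s}.
    z ^ inversions s \<tau> * prod_list (map (\<lambda>k. a (I k) (J (\<tau> k))) [1..<Suc s]))"
  proof (rule sum.cong[OF refl])
    fix \<tau> assume "\<tau> \<in> {\<tau>. \<tau> permutes {1..s}}"
    then have "set (map \<tau> [1..<Suc s]) \<subseteq> {1..s}"
      by (simp only: set_map set_upt atLeastLessThanSuc_atLeastAtMost mem_Collect_eq permutes_image)
    then have "list_inversions (map (\<lambda>k. J (\<tau> k)) [1..<Suc s]) = inversions s \<tau>"
      using list_inversions_map_strict_mono[OF assms, of "map \<tau> [1..<Suc s]"]
      by (simp only: list_inversions_permutation map_map o_def)
    moreover have "map2 a (map I [1..<Suc s]) (map (\<lambda>k. J (\<tau> k)) [1..<Suc s]) =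
        map (\<lambda>k. a (I k) (J (\<tau> k))) [1..<Suc s]"
      by (simp add: zip_map_map zip_same_conv_map o_def del: upt_Suc)
    ultimately show "z ^ list_inversions (map (\<lambda>k. J (\<tau> k)) [1..<Suc s]) *
        prod_list (map2 a (map I [1..<Suc s]) (map (\<lambda>k. J (\<tau> k)) [1..<Suc s])) =
      z ^ inversions s \<tau> * prod_list (map (\<lambda>k. a (I k) (J (\<tau> k))) [1..<Suc s])"
      by (simp only:)
  qed
  finally show ?thesis .
qed

text \<open>An increasing function on an interval enumerates its image in increasing order, and
  there is only one such enumeration.\<close>

lemma strict_mono_on_eq_if_image_eq:
  fixes f g :: "nat \<Rightarrow> nat"
  assumes "strict_mono_on {m..<n} f" "strict_mono_on {m..<n} g" "f ` {m..<n} = g ` {m..<n}" "k \<in> {m..<n}"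
  shows "f k = g k"
proof -
  have sorted: "sorted_list_of_set (h ` {m..<n}) = map h [m..<n]" if "strict_mono_on {m..<n} h"
    for h :: "nat \<Rightarrow> nat"
  proof -
    have "sorted_wrt (\<lambda>x y. h x < h y) [m..<n]"
      by (rule sorted_wrt_mono_rel[OF _ sorted_wrt_upt]) (use that in \<open>auto simp: strict_mono_on_def\<close>)
    then have "sorted (map h [m..<n])"
      by (simp add: sorted_map) (auto intro: sorted_wrt_mono_rel[rotated])
    moreover have "distinct (map h [m..<n])"
      using that by (simp add: distinct_map strict_mono_on_imp_inj_on)
    ultimately show ?thesis
      using sorted_list_of_set.idem_if_sorted_distinct[of "map h [m..<n]"] by simp
  qed
  have "map f [m..<n] = map g [m..<n]" using sorted[OF assms(1)] sorted[OF assms(2)] unfolding assms(3) by (rule trans[OF sym])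
  then have "\<forall>x\<in>{m..<n}. f x = g x" by (simp only: map_eq_conv set_upt)
  then show ?thesis using assms(4) by (rule bspec)
qed

section \<open>The index permutations as subsets\<close>

context
  fixes n r :: nat
  assumes rn: "r < n"
begin

text \<open>Everything is expressed through the image of \<open>{r + 1..n}\<close>, the columns of
  one minor apart from \<open>1, ..., r\<close>; it plays the part of \<open>A\<close> in the
  identities over a ring.\<close>

lemma plucker_perms_D:
  assumes "\<sigma> \<in> plucker_perms n r"
  shows "\<sigma> ` {r + 1..n} \<subseteq> {r + 1..2 * n}" "card (\<sigma> ` {r + 1..n}) = n - r"
    "\<sigma> ` {1..n} = {1..r} \<union> \<sigma> ` {r + 1..n}"
    "\<sigma> ` {n + 1..2 * n} = {r + 1..2 * n} - \<sigma> ` {r + 1..n}"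
    "strict_mono_on {1..n} \<sigma>" "strict_mono_on {1..n} (\<lambda>k. \<sigma> (n + k))"
    "inversions (2 * n) \<sigma> =
      crossings (\<sigma> ` {r + 1..n}) ({r + 1..2 * n} - \<sigma> ` {r + 1..n})"
proof -
  have \<sigma>: "\<sigma> permutes {1..2 * n}" "\<And>k. k \<in> {1..r} \<Longrightarrow> \<sigma> k = k"
    "strict_mono_on {r + 1..n} \<sigma>" "strict_mono_on {n + 1..2 * n} \<sigma>"
    using assms by (auto simp: plucker_perms_def)
  have inj: "inj \<sigma>" using \<sigma>(1) by (rule permutes_inj)
  have D: "\<sigma> ` {1..r} = {1..r}" using \<sigma>(2) by (simp add: image_def)
  have rest: "\<sigma> ` {r + 1..2 * n} = {r + 1..2 * n}"
  proof -
    have "{r + 1..2 * n} = {1..2 * n} - {1..r}" using rn by auto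
    then show ?thesis by (simp only: image_set_diff[OF inj] D permutes_image[OF \<sigma>(1)])
  qed
  have "\<sigma> ` {r + 1..n} \<subseteq> \<sigma> ` {r + 1..2 * n}" by (rule image_mono) auto
  then show "\<sigma> ` {r + 1..n} \<subseteq> {r + 1..2 * n}" by (simp only: rest)
  show "card (\<sigma> ` {r + 1..n}) = n - r"
    using inj by (simp add: card_image inj_on_subset)
  have "{1..n} = {1..r} \<union> {r + 1..n}" using rn by auto
  then show "\<sigma> ` {1..n} = {1..r} \<union> \<sigma> ` {r + 1..n}" by (simp only: image_Un D)
  have "{n + 1..2 * n} = {r + 1..2 * n} - {r + 1..n}" using rn by auto
  then show B: "\<sigma> ` {n + 1..2 * n} = {r + 1..2 * n} - \<sigma> ` {r + 1..n}"
    by (simp only: image_set_diff[OF inj] rest)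
  have gt: "r < \<sigma> k" if "r < k" "k \<le> 2 * n" for k
  proof -
    have "\<sigma> k \<in> \<sigma> ` {r + 1..2 * n}" using that by auto
    then show ?thesis unfolding rest by auto
  qed
  show mono: "strict_mono_on {1..n} \<sigma>"
  proof (rule strict_mono_onI)
    fix i j assume ij: "i \<in> {1..n}" "j \<in> {1..n}" "i < j"
    show "\<sigma> i < \<sigma> j"
    proof (cases "r < i")
      case True
      then show ?thesis using ij by (intro strict_mono_onD[OF \<sigma>(3)]) auto
    next
      case False
      then have i: "\<sigma> i = i" using ij \<sigma>(2) by auto
      show ?thesis using False i ij \<sigma>(2)[of j] gt[of j] by (cases "j \<le> r") auto
    qed
  qed
  show "strict_mono_on {1..n} (\<lambda>k. \<sigma> (n + k))"
    using \<sigma>(4) by (auto simp: strict_mono_on_def)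
  let ?X = "{(i, j). 1 \<le> i \<and> i < j \<and> j \<le> 2 * n \<and> \<sigma> j < \<sigma> i}"
  \<comment> \<open>There is no inversion inside \<open>{1..n}\<close> or inside
    \<open>{n + 1..2 * n}\<close>, and none starts at a fixed point, as all later values are
    larger.\<close>
  have X: "?X = {(i, j). i \<in> {r + 1..n} \<and> j \<in> {n + 1..2 * n} \<and> \<sigma> j < \<sigma> i}"
  proof -
    have "r < i \<and> i \<le> n \<and> n < j" if "1 \<le> i" "i < j" "j \<le> 2 * n" "\<sigma> j < \<sigma> i" for i j
    proof -
      have "\<not> (i \<le> n \<and> j \<le> n)" using strict_mono_onD[OF mono, of i j] that by auto
      moreover have "\<not> (n < i)" using strict_mono_onD[OF \<sigma>(4), of i j] that by auto
      moreover have "r < i"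
      proof (rule ccontr)
        assume "\<not> r < i"
        then show False using \<sigma>(2)[of i] \<sigma>(2)[of j] gt[of j] that by (cases "j \<le> r") auto
      qed
      ultimately show ?thesis by auto
    qed
    then have "(1 \<le> i \<and> i < j \<and> j \<le> 2 * n \<and> \<sigma> j < \<sigma> i) \<longleftrightarrow>
        (i \<in> {r + 1..n} \<and> j \<in> {n + 1..2 * n} \<and> \<sigma> j < \<sigma> i)" for i j
      unfolding atLeastAtMost_iff by fastforce
    then show ?thesis by (simp only:)
  qed
  have "card (map_prod \<sigma> \<sigma> ` ?X) = card ?X"
    by (intro card_image inj_on_subset[OF prod.inj_map[OF inj inj]] subset_UNIV)
  moreover have "map_prod \<sigma> \<sigma> ` ?X =
      {(x, y). x \<in> \<sigma> ` {r + 1..n} \<and> y \<in> \<sigma> ` {n + 1..2 * n} \<and> y < x}"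
    unfolding X by (auto simp: image_iff simp del: atLeastAtMost_iff)
  ultimately show "inversions (2 * n) \<sigma> =
      crossings (\<sigma> ` {r + 1..n}) ({r + 1..2 * n} - \<sigma> ` {r + 1..n})"
    by (simp only: inversions_def crossings_def B)
qed

text \<open>Both blocks are increasing, so a permutation is determined by the image of
  \<open>{r + 1..n}\<close>. Conversely, \<open>A\<close> and its complement are listed in
  increasing order after the fixed points.\<close>

lemma bij_betw_plucker_perms:
  "bij_betw (\<lambda>\<sigma>. \<sigma> ` {r + 1..n}) (plucker_perms n r)
    {A. A \<subseteq> {r + 1..2 * n} \<and> card A = n - r}"
  unfolding bij_betw_def
proof (intro conjI subset_antisym)
  show "inj_on (\<lambda>\<sigma>. \<sigma> ` {r + 1..n}) (plucker_perms n r)"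
  proof (rule inj_onI, rule ext)
    fix \<sigma> \<tau> k
    assume \<sigma>: "\<sigma> \<in> plucker_perms n r" and \<tau>: "\<tau> \<in> plucker_perms n r"
      and eq: "\<sigma> ` {r + 1..n} = \<tau> ` {r + 1..n}"
    have mono: "strict_mono_on {n + 1..2 * n} \<sigma>" "strict_mono_on {n + 1..2 * n} \<tau>"
      and perm: "\<sigma> permutes {1..2 * n}" "\<tau> permutes {1..2 * n}"
      using \<sigma> \<tau> by (auto simp: plucker_perms_def)
    consider "k \<in> {1..n}" | "k \<in> {n + 1..2 * n}" | "k \<notin> {1..2 * n}" by force
    then show "\<sigma> k = \<tau> k"
    proof cases
      case 1
      moreover have "\<sigma> ` {1..n} = \<tau> ` {1..n}"
        using plucker_perms_D(3)[OF \<sigma>] plucker_perms_D(3)[OF \<tau>] eq by simp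
      ultimately show ?thesis
        using strict_mono_on_eq_if_image_eq[of 1 "Suc n" \<sigma> \<tau> k]
          plucker_perms_D(5)[OF \<sigma>] plucker_perms_D(5)[OF \<tau>]
        by (simp only: atLeastLessThanSuc_atLeastAtMost)
    next
      case 2
      moreover have "\<sigma> ` {n + 1..2 * n} = \<tau> ` {n + 1..2 * n}"
        using plucker_perms_D(4)[OF \<sigma>] plucker_perms_D(4)[OF \<tau>] eq by simp
      ultimately show ?thesis
        using strict_mono_on_eq_if_image_eq[of "n + 1" "Suc (2 * n)" \<sigma> \<tau> k] mono
        by (simp only: atLeastLessThanSuc_atLeastAtMost)
    next
      case 3
      then show ?thesis using perm permutes_not_in by metis
    qed
  qed
  show "(\<lambda>\<sigma>. \<sigma> ` {r + 1..n}) ` plucker_perms n r \<subseteq> {A. A \<subseteq> {r + 1..2 * n} \<and> card A = n - r}"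
    using plucker_perms_D(1,2) by blast
  show "{A. A \<subseteq> {r + 1..2 * n} \<and> card A = n - r} \<subseteq> (\<lambda>\<sigma>. \<sigma> ` {r + 1..n}) ` plucker_perms n r"
  proof
    fix A assume "A \<in> {A. A \<subseteq> {r + 1..2 * n} \<and> card A = n - r}"
    then have A: "A \<subseteq> {r + 1..2 * n}" "card A = n - r" by auto
    let ?B = "{r + 1..2 * n} - A"
    have finA: "finite A" using A(1) by (rule finite_subset) auto
    \<comment> \<open>Of the \<open>2 * n - r\<close> values, \<open>n - r\<close> are in
      \<open>A\<close>, which leaves just enough for the second block.\<close>
    have cardB: "card ?B = n" using A finA rn by (simp add: card_Diff_subset)
    define xs ys where "xs = sorted_list_of_set A" and "ys = sorted_list_of_set ?B"
    \<comment> \<open>The lists are indexed from 0, while the blocks start at \<open>r + 1\<close>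
      and \<open>n + 1\<close>.\<close>
    define \<sigma> where "\<sigma> k = (if k \<in> {1..r} then k else if k \<in> {r + 1..n} then xs ! (k - (r + 1))
      else if k \<in> {n + 1..2 * n} then ys ! (k - (n + 1)) else k)" for k
    have xs: "length xs = n - r" "set xs = A" "sorted_wrt (<) xs"
      and ys: "length ys = n" "set ys = ?B" "sorted_wrt (<) ys"
      using finA A(2) cardB by (auto simp: xs_def ys_def)
    have imA: "\<sigma> ` {r + 1..n} = A"
    proof -
      have "\<sigma> ` {r + 1..n} = (\<lambda>k. xs ! (k - (r + 1))) ` {r + 1..n}"
        by (rule image_cong) (auto simp: \<sigma>_def)
      also have "\<dots> = (!) xs ` (\<lambda>k. k - (r + 1)) ` {r + 1..n}" by (simp add: image_image)
      also have "(\<lambda>k. k - (r + 1)) ` {r + 1..n} = {..<length xs}"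
        using rn by (auto simp: xs(1) image_iff intro!: bexI[of _ "_ + (r + 1)"])
      finally show ?thesis using xs(2) by (auto simp: in_set_conv_nth)
    qed
    have imB: "\<sigma> ` {n + 1..2 * n} = ?B"
    proof -
      have "\<sigma> ` {n + 1..2 * n} = (\<lambda>k. ys ! (k - (n + 1))) ` {n + 1..2 * n}"
        using rn by (intro image_cong) (auto simp: \<sigma>_def)
      also have "\<dots> = (!) ys ` (\<lambda>k. k - (n + 1)) ` {n + 1..2 * n}" by (simp add: image_image)
      also have "(\<lambda>k. k - (n + 1)) ` {n + 1..2 * n} = {..<length ys}"
        by (auto simp: ys(1) image_iff intro!: bexI[of _ "_ + (n + 1)"])
      finally show ?thesis unfolding ys(2)[symmetric] by (auto simp: in_set_conv_nth)
    qed
    have im: "\<sigma> ` {1..2 * n} = {1..2 * n}"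
    proof -
      have "{1..2 * n} = {1..r} \<union> {r + 1..n} \<union> {n + 1..2 * n}" using rn by auto
      then have "\<sigma> ` {1..2 * n} = \<sigma> ` {1..r} \<union> A \<union> ?B" by (simp only: image_Un imA imB)
      also have "\<sigma> ` {1..r} = {1..r}" by (auto simp: \<sigma>_def image_iff)
      finally show ?thesis using A rn by auto
    qed
    have "\<sigma> permutes {1..2 * n}"
    proof (rule bij_imp_permutes)
      show "bij_betw \<sigma> {1..2 * n} {1..2 * n}"
        \<comment> \<open>A map of a finite set onto itself is injective.\<close>
        unfolding bij_betw_def using im by (simp add: eq_card_imp_inj_on)
      show "\<sigma> k = k" if "k \<notin> {1..2 * n}" for k
        using that rn by (auto simp: \<sigma>_def)
    qed
    moreover have "strict_mono_on {r + 1..n} \<sigma>"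
    proof (rule strict_mono_onI)
      fix i j assume "i \<in> {r + 1..n}" "j \<in> {r + 1..n}" "i < j"
      then show "\<sigma> i < \<sigma> j"
        using sorted_wrt_nth_less[OF xs(3), of "i - (r + 1)" "j - (r + 1)"] xs(1)
        by (simp add: \<sigma>_def diff_less_mono)
    qed
    moreover have "strict_mono_on {n + 1..2 * n} \<sigma>"
    proof (rule strict_mono_onI)
      fix i j assume "i \<in> {n + 1..2 * n}" "j \<in> {n + 1..2 * n}" "i < j"
      then show "\<sigma> i < \<sigma> j"
        using sorted_wrt_nth_less[OF ys(3), of "i - (n + 1)" "j - (n + 1)"] ys(1) rn
        by (simp add: \<sigma>_def diff_less_mono)
    qed
    moreover have "\<forall>k\<in>{1..r}. \<sigma> k = k" by (simp add: \<sigma>_def)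
    ultimately have "\<sigma> \<in> plucker_perms n r" unfolding plucker_perms_def by blast
    then show "A \<in> (\<lambda>\<sigma>. \<sigma> ` {r + 1..n}) ` plucker_perms n r" using imA by blast
  qed
qed

end

section \<open>The product of all quantum matrix algebras\<close>

lemma free_smult_closed:
  "f \<in> carrier (free_algebra X) \<Longrightarrow> c \<odot>\<^bsub>free_algebra X\<^esub> f \<in> carrier (free_algebra X)"
  by (auto simp: free_algebra_def)

lemma var_closed: "x \<in> X \<Longrightarrow> var x \<in> carrier (free_algebra X)"
  by (auto simp: var_def free_algebra_def)

lemma free_smult:
  "(c \<odot>\<^bsub>free_algebra X\<^esub> f) \<otimes>\<^bsub>free_algebra X\<^esub> g = c \<odot>\<^bsub>free_algebra X\<^esub> (f \<otimes>\<^bsub>free_algebra X\<^esub> g)"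
  "f \<otimes>\<^bsub>free_algebra X\<^esub> (c \<odot>\<^bsub>free_algebra X\<^esub> g) = c \<odot>\<^bsub>free_algebra X\<^esub> (f \<otimes>\<^bsub>free_algebra X\<^esub> g)"
  "c \<odot>\<^bsub>free_algebra X\<^esub> (d \<odot>\<^bsub>free_algebra X\<^esub> f) = (c * d) \<odot>\<^bsub>free_algebra X\<^esub> f"
  "1 \<odot>\<^bsub>free_algebra X\<^esub> f = f"
  "(c + d) \<odot>\<^bsub>free_algebra X\<^esub> f = (c \<odot>\<^bsub>free_algebra X\<^esub> f) \<oplus>\<^bsub>free_algebra X\<^esub> (d \<odot>\<^bsub>free_algebra X\<^esub> f)"
  by (simp_all add: free_algebra_def sum_distrib_left mult.assoc mult.left_commute distrib_right)

section \<open>Computing in a single quotient algebra\<close>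

definition qclass ::
  "complex \<Rightarrow> nat \<Rightarrow> ((nat \<times> nat) list \<Rightarrow> complex) \<Rightarrow> ((nat \<times> nat) list \<Rightarrow> complex) set" where
  "qclass q N f = qmat_ideal q N +>\<^bsub>qmat_free N\<^esub> f"

lemma carrier_qmat: "carrier (qmat q N) = qclass q N ` carrier (qmat_free N)"
  by (auto simp: qmat_def ring.extend_def FactRing_def A_RCOSETS_def' qclass_def)

lemma qclass_ring_hom: "qclass q N \<in> ring_hom (qmat_free N) (qmat q N)"
proof -
  interpret I: ideal "qmat_ideal q N" "qmat_free N" by (rule ideal_qmat_ideal)
  show ?thesis
    using I.rcos_ring_hom
    by (simp add: ring_hom_def qmat_def ring.extend_def qclass_def fun_eq_iff[symmetric] Pi_iff)
qed

lemma qclass_closed: "f \<in> carrier (qmat_free N) \<Longrightarrow> qclass q N f \<in> carrier (qmat q N)"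
  unfolding carrier_qmat by (rule imageI)

lemma qclass_smult:
  "f \<in> carrier (qmat_free N) \<Longrightarrow>
    c \<odot>\<^bsub>qmat q N\<^esub> qclass q N f = qclass q N (c \<odot>\<^bsub>qmat_free N\<^esub> f)"
  unfolding qclass_def by (rule smult_qmat_coset)

lemma qclass_add:
  assumes "f \<in> carrier (qmat_free N)" "g \<in> carrier (qmat_free N)"
  shows "qclass q N (f \<oplus>\<^bsub>qmat_free N\<^esub> g) = qclass q N f \<oplus>\<^bsub>qmat q N\<^esub> qclass q N g"
  by (rule ring_hom_add[OF qclass_ring_hom assms])

lemma qclass_mult:
  assumes "f \<in> carrier (qmat_free N)" "g \<in> carrier (qmat_free N)"
  shows "qclass q N (f \<otimes>\<^bsub>qmat_free N\<^esub> g) = qclass q N f \<otimes>\<^bsub>qmat q N\<^esub> qclass q N g"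
  by (rule ring_hom_mult[OF qclass_ring_hom assms])

lemma qclass_minus:
  assumes "f \<in> carrier (qmat_free N)" "g \<in> carrier (qmat_free N)"
  shows "qclass q N (f \<ominus>\<^bsub>qmat_free N\<^esub> g) = qclass q N f \<ominus>\<^bsub>qmat q N\<^esub> qclass q N g"
proof -
  interpret ring_hom_ring "qmat_free N" "qmat q N" "qclass q N"
    by (rule ring_hom_ringI2[OF ring_free_algebra ring_qmat qclass_ring_hom])
  show ?thesis
    unfolding R.minus_eq S.minus_eq
    by (simp only: hom_add hom_a_inv R.a_inv_closed assms)
qed

lemma qclass_relator:
  assumes "f \<in> qmat_relators q N"
  shows "qclass q N f = \<zero>\<^bsub>qmat q N\<^esub>"
proof -
  interpret I: ideal "qmat_ideal q N" "qmat_free N" by (rule ideal_qmat_ideal)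
  have "f \<in> qmat_ideal q N"
    unfolding qmat_ideal_def
    using assms ring.genideal_self[OF ring_free_algebra qmat_relators_carrier] by blast
  then have "qclass q N f = qmat_ideal q N" unfolding qclass_def by (rule I.a_rcos_const)
  then show ?thesis by (simp add: qmat_def ring.extend_def FactRing_def)
qed

lemma qmat_smult_closed:
  "x \<in> carrier (qmat q N) \<Longrightarrow> c \<odot>\<^bsub>qmat q N\<^esub> x \<in> carrier (qmat q N)"
  unfolding carrier_qmat by (auto simp only: qclass_smult intro!: imageI free_smult_closed)

text \<open>Every element is a class, so the laws descend from the free algebra along
  \<open>qclass\<close>.\<close>

lemma qmat_smult:
  assumes "x \<in> carrier (qmat q N)"
  shows "c \<odot>\<^bsub>qmat q N\<^esub> (d \<odot>\<^bsub>qmat q N\<^esub> x) = (c * d) \<odot>\<^bsub>qmat q N\<^esub> x"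
    and "1 \<odot>\<^bsub>qmat q N\<^esub> x = x"
    and "(c + d) \<odot>\<^bsub>qmat q N\<^esub> x = (c \<odot>\<^bsub>qmat q N\<^esub> x) \<oplus>\<^bsub>qmat q N\<^esub> (d \<odot>\<^bsub>qmat q N\<^esub> x)"
proof -
  obtain f where f: "f \<in> carrier (qmat_free N)" "x = qclass q N f"
    using assms unfolding carrier_qmat by blast
  show "c \<odot>\<^bsub>qmat q N\<^esub> (d \<odot>\<^bsub>qmat q N\<^esub> x) = (c * d) \<odot>\<^bsub>qmat q N\<^esub> x"
    and "1 \<odot>\<^bsub>qmat q N\<^esub> x = x"
    and "(c + d) \<odot>\<^bsub>qmat q N\<^esub> x = (c \<odot>\<^bsub>qmat q N\<^esub> x) \<oplus>\<^bsub>qmat q N\<^esub> (d \<odot>\<^bsub>qmat q N\<^esub> x)"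
    by (simp_all only: f qclass_smult free_smult_closed qclass_add free_smult flip: qclass_add)
qed

lemma qmat_smult_mult:
  assumes "x \<in> carrier (qmat q N)" "y \<in> carrier (qmat q N)"
  shows "(c \<odot>\<^bsub>qmat q N\<^esub> x) \<otimes>\<^bsub>qmat q N\<^esub> y = c \<odot>\<^bsub>qmat q N\<^esub> (x \<otimes>\<^bsub>qmat q N\<^esub> y)"
    and "x \<otimes>\<^bsub>qmat q N\<^esub> (c \<odot>\<^bsub>qmat q N\<^esub> y) = c \<odot>\<^bsub>qmat q N\<^esub> (x \<otimes>\<^bsub>qmat q N\<^esub> y)"
proof -
  obtain f g where f: "f \<in> carrier (qmat_free N)" "x = qclass q N f"
    and g: "g \<in> carrier (qmat_free N)" "y = qclass q N g"
    using assms unfolding carrier_qmat by blast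
  show "(c \<odot>\<^bsub>qmat q N\<^esub> x) \<otimes>\<^bsub>qmat q N\<^esub> y = c \<odot>\<^bsub>qmat q N\<^esub> (x \<otimes>\<^bsub>qmat q N\<^esub> y)"
    and "x \<otimes>\<^bsub>qmat q N\<^esub> (c \<odot>\<^bsub>qmat q N\<^esub> y) = c \<odot>\<^bsub>qmat q N\<^esub> (x \<otimes>\<^bsub>qmat q N\<^esub> y)"
    by (simp_all only: f g qclass_smult free_smult_closed free_algebra_mult_closed free_smult
        flip: qclass_mult)
qed

lemma qmat_smult_uminus:
  assumes "x \<in> carrier (qmat q N)"
  shows "(- c) \<odot>\<^bsub>qmat q N\<^esub> x = \<ominus>\<^bsub>qmat q N\<^esub> (c \<odot>\<^bsub>qmat q N\<^esub> x)"
proof -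
  interpret ring "qmat q N" by (rule ring_qmat)
  \<comment> \<open>Additivity in the scalar shows that this element equals its own double, hence is
    zero.\<close>
  have "0 \<odot>\<^bsub>qmat q N\<^esub> x = 0 \<odot>\<^bsub>qmat q N\<^esub> x \<oplus>\<^bsub>qmat q N\<^esub> 0 \<odot>\<^bsub>qmat q N\<^esub> x"
    using qmat_smult(3)[OF assms, of 0 0] by simp
  then have "0 \<odot>\<^bsub>qmat q N\<^esub> x = \<zero>\<^bsub>qmat q N\<^esub>"
    using assms by (simp add: qmat_smult_closed)
  then have "(- c) \<odot>\<^bsub>qmat q N\<^esub> x \<oplus>\<^bsub>qmat q N\<^esub> c \<odot>\<^bsub>qmat q N\<^esub> x = \<zero>\<^bsub>qmat q N\<^esub>"
    using qmat_smult(3)[OF assms, of "- c" c] by simp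
  then show ?thesis using assms by (simp add: minus_equality qmat_smult_closed)
qed

lemma qgen_closed: "i \<in> {1..N} \<Longrightarrow> j \<in> {1..N} \<Longrightarrow> qgen q N i j \<in> carrier (qmat q N)"
  unfolding qgen_def qclass_def[symmetric] by (intro qclass_closed var_closed SigmaI)

text \<open>A relator lies in the ideal, so its class is zero; by the homomorphism laws this class
  is a difference of expressions in the generators.\<close>

lemma qgen_relations:
  fixes q :: complex and N i j k l :: nat
  assumes "i \<in> {1..N}" "j \<in> {1..N}" "k \<in> {1..N}" "l \<in> {1..N}" "k < l"
  defines "R \<equiv> qmat q N" and "x \<equiv> qgen q N"
  shows "x i k \<otimes>\<^bsub>R\<^esub> x i l = q \<odot>\<^bsub>R\<^esub> (x i l \<otimes>\<^bsub>R\<^esub> x i k)"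
    and "i < j \<Longrightarrow> x j k \<otimes>\<^bsub>R\<^esub> x i l = x i l \<otimes>\<^bsub>R\<^esub> x j k"
    and "i < j \<Longrightarrow> x i k \<otimes>\<^bsub>R\<^esub> x j l \<ominus>\<^bsub>R\<^esub> x j l \<otimes>\<^bsub>R\<^esub> x i k =
      (q - inverse q) \<odot>\<^bsub>R\<^esub> (x i l \<otimes>\<^bsub>R\<^esub> x j k)"
proof -
  let ?F = "qmat_free N" and ?v = "\<lambda>i j. var (i, j) :: (nat \<times> nat) list \<Rightarrow> complex"
  interpret F: ring ?F by (rule ring_free_algebra)
  interpret R: ring R unfolding R_def by (rule ring_qmat)
  have v: "?v i' j' \<in> carrier ?F" if "i' \<in> {1..N}" "j' \<in> {1..N}" for i' j'
    using that by (intro var_closed) auto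
  have eq: "f = g" if "f \<ominus>\<^bsub>R\<^esub> g = \<zero>\<^bsub>R\<^esub>" "f \<in> carrier R" "g \<in> carrier R" for f g
  proof -
    have "f = (f \<ominus>\<^bsub>R\<^esub> g) \<oplus>\<^bsub>R\<^esub> g" using that(2,3) by (simp add: R.minus_eq R.a_assoc R.l_neg)
    then show ?thesis using that by simp
  qed
  note simps = qclass_mult qclass_minus qclass_smult[symmetric] v assms(1-4) free_smult_closed
    free_algebra_mult_closed F.minus_closed
  have x: "x = (\<lambda>i j. qclass q N (?v i j))" by (simp add: x_def qgen_def qclass_def fun_eq_iff)
  have x_closed: "x i' j' \<in> carrier R" if "i' \<in> {1..N}" "j' \<in> {1..N}" for i' j'
    using that by (simp only: x_def R_def qgen_closed)
  note R_closed = R.m_closed R.minus_closed x_closed assms(1-4)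
    qmat_smult_closed[of _ q N, folded R_def]
  have "?v i k \<otimes>\<^bsub>?F\<^esub> ?v i l \<ominus>\<^bsub>?F\<^esub> q \<odot>\<^bsub>?F\<^esub> (?v i l \<otimes>\<^bsub>?F\<^esub> ?v i k) \<in> qmat_relators q N"
    unfolding qmat_relators_def Let_def using assms(1-5) by blast
  from qclass_relator[OF this]
  have "x i k \<otimes>\<^bsub>R\<^esub> x i l \<ominus>\<^bsub>R\<^esub> q \<odot>\<^bsub>R\<^esub> (x i l \<otimes>\<^bsub>R\<^esub> x i k) = \<zero>\<^bsub>R\<^esub>"
    by (simp only: x R_def simps)
  then show "x i k \<otimes>\<^bsub>R\<^esub> x i l = q \<odot>\<^bsub>R\<^esub> (x i l \<otimes>\<^bsub>R\<^esub> x i k)"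
    by (rule eq; intro R_closed)
  assume "i < j"
  have "?v j k \<otimes>\<^bsub>?F\<^esub> ?v i l \<ominus>\<^bsub>?F\<^esub> ?v i l \<otimes>\<^bsub>?F\<^esub> ?v j k \<in> qmat_relators q N"
    unfolding qmat_relators_def Let_def using assms(1-5) \<open>i < j\<close> by blast
  from qclass_relator[OF this]
  have "x j k \<otimes>\<^bsub>R\<^esub> x i l \<ominus>\<^bsub>R\<^esub> x i l \<otimes>\<^bsub>R\<^esub> x j k = \<zero>\<^bsub>R\<^esub>"
    by (simp only: x R_def simps)
  then show "x j k \<otimes>\<^bsub>R\<^esub> x i l = x i l \<otimes>\<^bsub>R\<^esub> x j k"
    by (rule eq; intro R_closed)
  have "(?v i k \<otimes>\<^bsub>?F\<^esub> ?v j l \<ominus>\<^bsub>?F\<^esub> ?v j l \<otimes>\<^bsub>?F\<^esub> ?v i k)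
      \<ominus>\<^bsub>?F\<^esub> (q - inverse q) \<odot>\<^bsub>?F\<^esub> (?v i l \<otimes>\<^bsub>?F\<^esub> ?v j k) \<in> qmat_relators q N"
    unfolding qmat_relators_def Let_def using assms(1-5) \<open>i < j\<close> by blast
  from qclass_relator[OF this]
  have "(x i k \<otimes>\<^bsub>R\<^esub> x j l \<ominus>\<^bsub>R\<^esub> x j l \<otimes>\<^bsub>R\<^esub> x i k) \<ominus>\<^bsub>R\<^esub>
      (q - inverse q) \<odot>\<^bsub>R\<^esub> (x i l \<otimes>\<^bsub>R\<^esub> x j k) = \<zero>\<^bsub>R\<^esub>"
    by (simp only: x R_def simps)
  then show "x i k \<otimes>\<^bsub>R\<^esub> x j l \<ominus>\<^bsub>R\<^esub> x j l \<otimes>\<^bsub>R\<^esub> x i k =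
      (q - inverse q) \<odot>\<^bsub>R\<^esub> (x i l \<otimes>\<^bsub>R\<^esub> x j k)"
    by (rule eq; intro R_closed)
qed

section \<open>The product ring and its quantum matrix\<close>

text \<open>A type cannot depend on \<open>q\<close> and \<open>N\<close>, so the ring operations are put on the product of the
  algebras over all parameters, with \<open>q = 0\<close> replaced by \<open>q = 1\<close>. The generators with an index
  outside \<open>{1..N}\<close> are set to \<open>0\<close>, which preserves all relations. An identity in the product is then
  read off at the component \<open>(q, N)\<close>.\<close>

definition nonzero_or_one :: "complex \<Rightarrow> complex" where
  "nonzero_or_one q = (if q = 0 then 1 else q)"

lemma nonzero_or_one [simp]: "nonzero_or_one q \<noteq> 0" "q \<noteq> 0 \<Longrightarrow> nonzero_or_one q = q"
  by (simp_all add: nonzero_or_one_def)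

definition qmat_at :: "complex \<times> nat \<Rightarrow> (complex, ((nat \<times> nat) list \<Rightarrow> complex) set) module" where
  "qmat_at p = qmat (nonzero_or_one (fst p)) (snd p)"

typedef qmat_product =
  "{h :: complex \<times> nat \<Rightarrow> ((nat \<times> nat) list \<Rightarrow> complex) set. \<forall>p. h p \<in> carrier (qmat_at p)}"
  morphisms component qmat_product
proof
  show "(\<lambda>p. \<zero>\<^bsub>qmat_at p\<^esub>) \<in> {h. \<forall>p. h p \<in> carrier (qmat_at p)}"
    by (auto simp: qmat_at_def intro: abelian_monoid.zero_closed ring.is_abelian_group
        abelian_group.axioms(1) ring_qmat)
qed

setup_lifting type_definition_qmat_product

lemma ring_qmat_at: "ring (qmat_at p)"
  by (simp add: qmat_at_def ring_qmat)

lemma component_closed: "component x p \<in> carrier (qmat_at p)"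
  using component[of x] by (cases p) simp

lemma qmat_product_eqI: "(\<And>p. component x p = component y p) \<Longrightarrow> x = y"
  by (simp add: component_inject[symmetric] fun_eq_iff)

text \<open>This sort describes unital rings in which \<open>0\<close> and \<open>1\<close> may
  coincide; \<open>ring_1\<close> would ask for a proof that the product is nontrivial.\<close>

instantiation qmat_product :: "{ring,monoid_mult}"
begin

lift_definition zero_qmat_product :: qmat_product is "\<lambda>p. \<zero>\<^bsub>qmat_at p\<^esub>"
  using ring_qmat_at by (simp add: ring.ring_simprules)

lift_definition one_qmat_product :: qmat_product is "\<lambda>p. \<one>\<^bsub>qmat_at p\<^esub>"
  using ring_qmat_at by (simp add: ring.ring_simprules)

lift_definition plus_qmat_product :: "qmat_product \<Rightarrow> qmat_product \<Rightarrow> qmat_product"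
  is "\<lambda>f g p. f p \<oplus>\<^bsub>qmat_at p\<^esub> g p"
  using ring_qmat_at by (simp add: ring.ring_simprules)

lift_definition times_qmat_product :: "qmat_product \<Rightarrow> qmat_product \<Rightarrow> qmat_product"
  is "\<lambda>f g p. f p \<otimes>\<^bsub>qmat_at p\<^esub> g p"
  using ring_qmat_at by (simp add: ring.ring_simprules)

lift_definition uminus_qmat_product :: "qmat_product \<Rightarrow> qmat_product"
  is "\<lambda>f p. \<ominus>\<^bsub>qmat_at p\<^esub> f p"
  using ring_qmat_at by (simp add: ring.ring_simprules)

lift_definition minus_qmat_product :: "qmat_product \<Rightarrow> qmat_product \<Rightarrow> qmat_product"
  is "\<lambda>f g p. f p \<ominus>\<^bsub>qmat_at p\<^esub> g p"
  using ring_qmat_at by (simp add: ring.ring_simprules)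

instance
proof
  fix x y z :: qmat_product
  interpret ring "qmat_at p" for p by (rule ring_qmat_at)
  note ops = zero_qmat_product.rep_eq one_qmat_product.rep_eq plus_qmat_product.rep_eq
    times_qmat_product.rep_eq uminus_qmat_product.rep_eq minus_qmat_product.rep_eq
    component_closed
  show "x + y + z = x + (y + z)" by (rule qmat_product_eqI) (simp add: ops a_assoc)
  show "x + y = y + x" by (rule qmat_product_eqI) (simp add: ops a_comm)
  show "0 + x = x" by (rule qmat_product_eqI) (simp add: ops)
  show "- x + x = 0" by (rule qmat_product_eqI) (simp add: ops l_neg)
  show "x - y = x + - y" by (rule qmat_product_eqI) (simp add: ops minus_eq)
  show "x * y * z = x * (y * z)" by (rule qmat_product_eqI) (simp add: ops m_assoc)
  show "(x + y) * z = x * z + y * z" by (rule qmat_product_eqI) (simp add: ops l_distr)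
  show "x * (y + z) = x * y + x * z" by (rule qmat_product_eqI) (simp add: ops r_distr)
  show "1 * x = x" by (rule qmat_product_eqI) (simp add: ops)
  show "x * 1 = x" by (rule qmat_product_eqI) (simp add: ops)
qed

end

lemma component_sum:
  "finite A \<Longrightarrow> component (sum f A) p = (\<Oplus>\<^bsub>qmat_at p\<^esub>x\<in>A. component (f x) p)"
proof (induction A rule: finite_induct)
  case empty
  interpret ring "qmat_at p" by (rule ring_qmat_at)
  show ?case by (simp add: zero_qmat_product.rep_eq)
next
  case (insert a A)
  interpret ring "qmat_at p" by (rule ring_qmat_at)
  show ?case using insert by (simp add: plus_qmat_product.rep_eq component_closed)
qed

lemma component_prod_list:
  "component (prod_list (map f ks)) p =
    foldr (\<lambda>k y. component (f k) p \<otimes>\<^bsub>qmat_at p\<^esub> y) ks \<one>\<^bsub>qmat_at p\<^esub>"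
  by (induction ks) (simp_all add: one_qmat_product.rep_eq times_qmat_product.rep_eq)

text \<open>A scalar may depend on the parameter, so that one element of the product, such as
  \<open>scalar uminus\<close>, stands for \<open>- q\<close> in all components with
  \<open>q \<noteq> 0\<close> at once.\<close>

lift_definition scalar :: "(complex \<Rightarrow> complex) \<Rightarrow> qmat_product"
  is "\<lambda>c p. c (nonzero_or_one (fst p)) \<odot>\<^bsub>qmat_at p\<^esub> \<one>\<^bsub>qmat_at p\<^esub>"
  using ring_qmat_at by (simp add: qmat_at_def qmat_smult_closed ring.ring_simprules)

lift_definition generator :: "nat \<Rightarrow> nat \<Rightarrow> qmat_product"
  is "\<lambda>i j p. if i \<in> {1..snd p} \<and> j \<in> {1..snd p} then qgen (nonzero_or_one (fst p)) (snd p) i j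
    else \<zero>\<^bsub>qmat_at p\<^esub>"
  using ring_qmat_at by (auto simp: qmat_at_def qgen_closed ring.ring_simprules simp del: atLeastAtMost_iff)

lemma component_scalar_times:
  "component (scalar c * x) p = c (nonzero_or_one (fst p)) \<odot>\<^bsub>qmat_at p\<^esub> component x p"
proof -
  interpret ring "qmat_at p" by (rule ring_qmat_at)
  show ?thesis
    using component_closed[of x p] one_closed l_one
    by (simp add: times_qmat_product.rep_eq scalar.rep_eq qmat_at_def qmat_smult_mult)
qed

lemma component_times_scalar:
  "component (x * scalar c) p = c (nonzero_or_one (fst p)) \<odot>\<^bsub>qmat_at p\<^esub> component x p"
proof -
  interpret ring "qmat_at p" by (rule ring_qmat_at)
  show ?thesis
    using component_closed[of x p] one_closed r_one
    by (simp add: times_qmat_product.rep_eq scalar.rep_eq qmat_at_def qmat_smult_mult)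
qed

lemma component_scalar_power_times:
  "component (scalar c ^ m * x) p = (c (nonzero_or_one (fst p)) ^ m) \<odot>\<^bsub>qmat_at p\<^esub> component x p"
proof (induction m)
  case 0
  show ?case using component_closed[of x p] by (simp add: qmat_at_def qmat_smult)
next
  case (Suc m)
  then show ?case
    using component_closed[of x p]
    by (simp add: mult.assoc component_scalar_times) (simp add: qmat_at_def qmat_smult)
qed

lemma qmat_smult_zero: "c \<odot>\<^bsub>qmat q N\<^esub> \<zero>\<^bsub>qmat q N\<^esub> = \<zero>\<^bsub>qmat q N\<^esub>"
proof -
  interpret ring "qmat q N" by (rule ring_qmat)
  show ?thesis
    using qmat_smult_mult(1)[of "\<zero>\<^bsub>qmat q N\<^esub>" q N "\<zero>\<^bsub>qmat q N\<^esub>" c]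
    by (simp add: qmat_smult_closed)
qed

text \<open>Here \<open>z\<close> is \<open>- q\<close> and \<open>w\<close> is
  \<open>- inverse q\<close> in each component, so \<open>z * w = 1\<close> and
  \<open>w - z = q - inverse q\<close>; \<open>nonzero_or_one\<close> guarantees that
  \<open>q\<close> is invertible there.\<close>

interpretation product: quantum_matrix "scalar uminus" "scalar (\<lambda>q. - inverse q)" generator
proof
  fix x show "x * scalar uminus = scalar uminus * x"
    and "x * scalar (\<lambda>q. - inverse q) = scalar (\<lambda>q. - inverse q) * x"
    by (rule qmat_product_eqI, simp add: component_times_scalar component_scalar_times)+
next
  show "scalar uminus * scalar (\<lambda>q. - inverse q) = 1"
  proof (rule qmat_product_eqI)
    fix p
    interpret ring "qmat_at p" by (rule ring_qmat_at)
    show "component (scalar uminus * scalar (\<lambda>q. - inverse q)) p = component 1 p"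
      using one_closed
      by (simp add: component_scalar_times scalar.rep_eq one_qmat_product.rep_eq qmat_at_def qmat_smult)
  qed
next
  fix i k l :: nat assume "k < l"
  show "generator i k * generator i l = - (scalar uminus * (generator i l * generator i k))"
  proof (rule qmat_product_eqI)
    fix p :: "complex \<times> nat"
    define q N where "q = nonzero_or_one (fst p)" and "N = snd p"
    have R: "qmat_at p = qmat q N" by (simp add: q_def N_def qmat_at_def)
    interpret ring "qmat q N" by (rule ring_qmat)
    have "component (- (scalar uminus * y)) p = q \<odot>\<^bsub>qmat q N\<^esub> component y p" for y
      using component_closed[of y p]
      by (simp add: uminus_qmat_product.rep_eq component_scalar_times R qmat_smult_uminus
          qmat_smult_closed flip: q_def)
    note neg = this
    show "component (generator i k * generator i l) p =
        component (- (scalar uminus * (generator i l * generator i k))) p"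
    proof (cases "i \<in> {1..N} \<and> k \<in> {1..N} \<and> l \<in> {1..N}")
      case True
      then show ?thesis
        using qgen_relations(1)[of i N i k l q] \<open>k < l\<close>
        unfolding neg by (simp add: times_qmat_product.rep_eq generator.rep_eq R flip: q_def N_def)
    next
      \<comment> \<open>An index out of range makes one of the two factors zero, and both products
        contain both factors.\<close>
      case False
      then have "component (generator i k) p = \<zero>\<^bsub>qmat q N\<^esub> \<or> component (generator i l) p = \<zero>\<^bsub>qmat q N\<^esub>"
        by (auto simp: generator.rep_eq R simp flip: N_def)
      then show ?thesis
        using component_closed[of _ p] unfolding neg
        by (auto simp: times_qmat_product.rep_eq R qmat_smult_zero)
    qed
  qed
next
  fix i j k l :: nat assume "i < j" "k < l"
  show "generator j k * generator i l = generator i l * generator j k"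
  proof (rule qmat_product_eqI)
    fix p :: "complex \<times> nat"
    define q N where "q = nonzero_or_one (fst p)" and "N = snd p"
    have R: "qmat_at p = qmat q N" by (simp add: q_def N_def qmat_at_def)
    interpret ring "qmat q N" by (rule ring_qmat)
    show "component (generator j k * generator i l) p = component (generator i l * generator j k) p"
      using qgen_relations(2)[of i N j k l q] \<open>k < l\<close> \<open>i < j\<close>
      by (auto simp: times_qmat_product.rep_eq generator.rep_eq R qgen_closed
          simp del: atLeastAtMost_iff simp flip: q_def N_def)
  qed
  show "generator i k * generator j l - generator j l * generator i k =
    (scalar (\<lambda>q. - inverse q) - scalar uminus) * (generator i l * generator j k)"
  proof (rule qmat_product_eqI)
    fix p :: "complex \<times> nat"
    define q N where "q = nonzero_or_one (fst p)" and "N = snd p"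
    have R: "qmat_at p = qmat q N" by (simp add: q_def N_def qmat_at_def)
    interpret ring "qmat q N" by (rule ring_qmat)
    have "(- inverse q) \<odot>\<^bsub>qmat q N\<^esub> y \<ominus>\<^bsub>qmat q N\<^esub> (- q) \<odot>\<^bsub>qmat q N\<^esub> y = (q - inverse q) \<odot>\<^bsub>qmat q N\<^esub> y"
      if "y \<in> carrier (qmat q N)" for y
      using qmat_smult(3)[OF that, of "- inverse q" q] qmat_smult_uminus[OF that, of "- q"]
      by (simp add: minus_eq)
    then have "component ((scalar (\<lambda>q. - inverse q) - scalar uminus) * y) p =
        (q - inverse q) \<odot>\<^bsub>qmat q N\<^esub> component y p" for y
      using component_closed[of y p]
      by (simp add: left_diff_distrib minus_qmat_product.rep_eq component_scalar_times R flip: q_def)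
    note diff = this
    show "component (generator i k * generator j l - generator j l * generator i k) p =
        component ((scalar (\<lambda>q. - inverse q) - scalar uminus) * (generator i l * generator j k)) p"
      unfolding diff
      \<comment> \<open>All four indices occur in each product, so a single one out of range makes
        every product zero.\<close>
      using qgen_relations(3)[of i N j k l q] \<open>k < l\<close> \<open>i < j\<close>
      by (auto simp: times_qmat_product.rep_eq minus_qmat_product.rep_eq
          generator.rep_eq R qmat_smult_zero qgen_closed minus_eq
          simp del: atLeastAtMost_iff simp flip: q_def N_def)
  qed
qed

section \<open>Quantum Pluecker relations\<close>

text \<open>Reads \<open>minor_permutes\<close> at the component \<open>(q, N)\<close>. The bounds
  on \<open>J\<close> and \<open>s\<close> keep all indices in the range where
  \<open>generator\<close> yields \<open>qgen\<close>.\<close>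

lemma component_minor:
  assumes "q \<noteq> 0" "strict_mono_on {1..s} J" "J ` {1..s} \<subseteq> {1..N}" "s \<le> N"
  shows "component (product.minor [1..<Suc s] (J ` {1..s})) (q, N) = qminor q N s (\<lambda>k. k) J"
proof -
  interpret ring "qmat q N" by (rule ring_qmat)
  have R: "qmat_at (q, N) = qmat q N" using assms(1) by (simp add: qmat_at_def)
  have "component (scalar uminus ^ inversions s \<tau> *
        prod_list (map (\<lambda>k. generator k (J (\<tau> k))) [1..<Suc s])) (q, N) =
      (- q) ^ inversions s \<tau> \<odot>\<^bsub>qmat q N\<^esub>
        foldr (\<lambda>k y. qgen q N k (J (\<tau> k)) \<otimes>\<^bsub>qmat q N\<^esub> y) [1..<Suc s] \<one>\<^bsub>qmat q N\<^esub>"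
    if "\<tau> permutes {1..s}" for \<tau>
  proof -
    have "component (generator k (J (\<tau> k))) (q, N) = qgen q N k (J (\<tau> k))" if "k \<in> set [1..<Suc s]" for k
    proof -
      have k: "k \<in> {1..s}" using that by auto
      then have "\<tau> k \<in> {1..s}" using permutes_in_image[OF \<open>\<tau> permutes {1..s}\<close>] by blast
      then have "J (\<tau> k) \<in> {1..N}" using assms(3) by blast
      then show ?thesis using k assms(1,4) by (simp add: generator.rep_eq)
    qed
    then have "foldr (\<lambda>k y. component (generator k (J (\<tau> k))) (q, N) \<otimes>\<^bsub>qmat q N\<^esub> y) [1..<Suc s] \<one>\<^bsub>qmat q N\<^esub> =
        foldr (\<lambda>k y. qgen q N k (J (\<tau> k)) \<otimes>\<^bsub>qmat q N\<^esub> y) [1..<Suc s] \<one>\<^bsub>qmat q N\<^esub>"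
      by (intro foldr_cong) auto
    then show ?thesis
      using assms(1) by (simp only: component_scalar_power_times component_prod_list R fst_conv nonzero_or_one(2)[OF assms(1)])
  qed
  note summand = this
  have "component (product.minor [1..<Suc s] (J ` {1..s})) (q, N) =
    (\<Oplus>\<^bsub>qmat q N\<^esub>\<tau>\<in>{\<tau>. \<tau> permutes {1..s}}. component (scalar uminus ^ inversions s \<tau> *
        prod_list (map (\<lambda>k. generator k (J (\<tau> k))) [1..<Suc s])) (q, N))"
    using product.minor_permutes[OF assms(2), of "\<lambda>k. k"]
    by (simp only: list.map_ident component_sum finite_permutations finite_atLeastAtMost R)
  also have "\<dots> = qminor q N s (\<lambda>k. k) J"
    unfolding qminor_def
  proof (rule finsum_cong'[OF refl])
    show "(\<lambda>\<tau>. (- q) ^ inversions s \<tau> \<odot>\<^bsub>qmat q N\<^esub>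
        foldr (\<lambda>k y. qgen q N k (J (\<tau> k)) \<otimes>\<^bsub>qmat q N\<^esub> y) [1..<Suc s] \<one>\<^bsub>qmat q N\<^esub>)
      \<in> {\<tau>. \<tau> permutes {1..s}} \<rightarrow> carrier (qmat q N)"
    proof (rule Pi_I, drule CollectD)
      fix \<tau> assume "\<tau> permutes {1..s}"
      from component_closed[of "scalar uminus ^ inversions s \<tau> *
          prod_list (map (\<lambda>k. generator k (J (\<tau> k))) [1..<Suc s])" "(q, N)"]
      show "(- q) ^ inversions s \<tau> \<odot>\<^bsub>qmat q N\<^esub>
          foldr (\<lambda>k y. qgen q N k (J (\<tau> k)) \<otimes>\<^bsub>qmat q N\<^esub> y) [1..<Suc s] \<one>\<^bsub>qmat q N\<^esub> \<in> carrier (qmat q N)"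
        by (simp only: summand[OF \<open>\<tau> permutes {1..s}\<close>] R)
    qed
  qed (simp only: mem_Collect_eq summand)
  finally show ?thesis .
qed

text \<open>The passage from subsets to permutations, common to both identities:
  \<open>f S T\<close> stands for the product, in either order, of the minors with column sets
  \<open>S\<close> and \<open>T\<close>. Subsets of the wrong size drop out by \<open>supp\<close>;
  the others correspond to the permutations.\<close>

lemma component_sum_plucker_perms:
  fixes c :: "complex \<Rightarrow> complex" and f :: "nat set \<Rightarrow> nat set \<Rightarrow> qmat_product"
  assumes "q \<noteq> 0" "r < n"
    and zero: "(\<Sum>A\<in>Pow {r + 1..2 * n}. scalar c ^ crossings A ({r + 1..2 * n} - A) *
      f ({1..r} \<union> A) ({r + 1..2 * n} - A)) = 0"
    and supp: "\<And>S T. finite S \<Longrightarrow> card S \<noteq> n \<Longrightarrow> f S T = 0"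
    and g: "\<And>\<sigma>. \<sigma> \<in> plucker_perms n r \<Longrightarrow>
      component (f (\<sigma> ` {1..n}) (\<sigma> ` {n + 1..2 * n})) (q, 2 * n) = g \<sigma>"
  shows "(\<Oplus>\<^bsub>qmat q (2 * n)\<^esub>\<sigma>\<in>plucker_perms n r.
      c q ^ inversions (2 * n) \<sigma> \<odot>\<^bsub>qmat q (2 * n)\<^esub> g \<sigma>) = \<zero>\<^bsub>qmat q (2 * n)\<^esub>"
proof -
  let ?C = "{r + 1..2 * n}" and ?R = "qmat q (2 * n)"
  interpret ring ?R by (rule ring_qmat)
  have R: "qmat_at (q, 2 * n) = ?R" using assms(1) by (simp add: qmat_at_def)
  let ?F = "\<lambda>A. scalar c ^ crossings A (?C - A) * f ({1..r} \<union> A) (?C - A)"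
  let ?G = "\<lambda>\<sigma>. scalar c ^ inversions (2 * n) \<sigma> * f (\<sigma> ` {1..n}) (\<sigma> ` {n + 1..2 * n})"
  have "plucker_perms n r \<subseteq> {\<sigma>. \<sigma> permutes {1..2 * n}}" by (auto simp: plucker_perms_def)
  then have fin: "finite (plucker_perms n r)"
    by (rule finite_subset) (simp add: finite_permutations)
  have "0 = sum ?F {A. A \<subseteq> ?C \<and> card A = n - r}"
    unfolding zero[symmetric]
  proof (rule sum.mono_neutral_right)
    show "\<forall>A\<in>Pow ?C - {A. A \<subseteq> ?C \<and> card A = n - r}. ?F A = 0"
    proof
      fix A assume A: "A \<in> Pow ?C - {A. A \<subseteq> ?C \<and> card A = n - r}"
      then have "finite A" by (auto intro: finite_subset)
      moreover have "{1..r} \<inter> A = {}" using A by force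
      \<comment> \<open>The columns \<open>1, ..., r\<close> are already present, so
        \<open>n\<close> columns in all means \<open>card A = n - r\<close>.\<close>
      ultimately have "card ({1..r} \<union> A) = r + card A" by (subst card_Un_disjoint) auto
      then have "card ({1..r} \<union> A) \<noteq> n" using A assms(2) by auto
      then show "?F A = 0" using \<open>finite A\<close> supp by simp
    qed
  qed auto
  also have "\<dots> = (\<Sum>\<sigma>\<in>plucker_perms n r. ?F (\<sigma> ` {r + 1..n}))"
    by (rule sum.reindex_bij_betw[OF bij_betw_plucker_perms[OF assms(2)], symmetric])
  also have "\<dots> = sum ?G (plucker_perms n r)"
    by (rule sum.cong[OF refl]) (simp only: plucker_perms_D(3,4,7)[OF assms(2)])
  finally have "component (sum ?G (plucker_perms n r)) (q, 2 * n) = \<zero>\<^bsub>?R\<^esub>"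
    by (simp add: zero_qmat_product.rep_eq R flip: \<open>0 = sum ?F _\<close>)
  then have sum0: "(\<Oplus>\<^bsub>?R\<^esub>\<sigma>\<in>plucker_perms n r. component (?G \<sigma>) (q, 2 * n)) = \<zero>\<^bsub>?R\<^esub>"
    by (simp only: component_sum[OF fin] R)
  have comp: "component (?G \<sigma>) (q, 2 * n) = c q ^ inversions (2 * n) \<sigma> \<odot>\<^bsub>?R\<^esub> g \<sigma>"
    if "\<sigma> \<in> plucker_perms n r" for \<sigma>
    using assms(1) by (simp only: component_scalar_power_times R g[OF that] fst_conv nonzero_or_one(2)[OF assms(1)])
  have "(\<Oplus>\<^bsub>?R\<^esub>\<sigma>\<in>plucker_perms n r. c q ^ inversions (2 * n) \<sigma> \<odot>\<^bsub>?R\<^esub> g \<sigma>) =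
      (\<Oplus>\<^bsub>?R\<^esub>\<sigma>\<in>plucker_perms n r. component (?G \<sigma>) (q, 2 * n))"
  proof (rule finsum_cong'[OF refl])
    show "(\<lambda>\<sigma>. component (?G \<sigma>) (q, 2 * n)) \<in> plucker_perms n r \<rightarrow> carrier ?R"
      using component_closed[of _ "(q, 2 * n)"] by (simp only: R Pi_iff) blast
  qed (simp only: comp)
  then show ?thesis using sum0 by simp
qed

theorem proposition2p3:
  fixes q :: complex and n r :: nat
  assumes "q \<noteq> 0" and "n \<ge> 1" and "r < n"
  shows "(\<Oplus>\<^bsub>qmat q (2 * n)\<^esub>\<sigma>\<in>plucker_perms n r.
            (- q) ^ inversions (2 * n) \<sigma> \<odot>\<^bsub>qmat q (2 * n)\<^esub>
              (qminor q (2 * n) n (\<lambda>k. k) \<sigma>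
                \<otimes>\<^bsub>qmat q (2 * n)\<^esub> qminor q (2 * n) n (\<lambda>k. k) (\<lambda>k. \<sigma> (n + k))))
          = \<zero>\<^bsub>qmat q (2 * n)\<^esub>
       \<and> (\<Oplus>\<^bsub>qmat q (2 * n)\<^esub>\<sigma>\<in>plucker_perms n r.
            (- q) powi (- int (inversions (2 * n) \<sigma>)) \<odot>\<^bsub>qmat q (2 * n)\<^esub>
              (qminor q (2 * n) n (\<lambda>k. k) (\<lambda>k. \<sigma> (n + k))
                \<otimes>\<^bsub>qmat q (2 * n)\<^esub> qminor q (2 * n) n (\<lambda>k. k) \<sigma>))
          = \<zero>\<^bsub>qmat q (2 * n)\<^esub>"
proof -
  let ?rows = "[1..<Suc n]" and ?R = "qmat q (2 * n)"
  have R: "qmat_at (q, 2 * n) = ?R" using assms(1) by (simp add: qmat_at_def)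
  have minors: "component (product.minor ?rows (\<sigma> ` {1..n})) (q, 2 * n) = qminor q (2 * n) n (\<lambda>k. k) \<sigma>"
    "component (product.minor ?rows (\<sigma> ` {n + 1..2 * n})) (q, 2 * n) =
      qminor q (2 * n) n (\<lambda>k. k) (\<lambda>k. \<sigma> (n + k))"
    if "\<sigma> \<in> plucker_perms n r" for \<sigma>
  proof -
    have perm: "\<sigma> permutes {1..2 * n}" using that by (simp add: plucker_perms_def)
    have range: "\<sigma> ` S \<subseteq> {1..2 * n}" if "S \<subseteq> {1..2 * n}" for S
      using image_mono[OF that, of \<sigma>] unfolding permutes_image[OF perm] .
    show "component (product.minor ?rows (\<sigma> ` {1..n})) (q, 2 * n) = qminor q (2 * n) n (\<lambda>k. k) \<sigma>"
      using plucker_perms_D(5)[OF assms(3) that] by (intro component_minor assms range) auto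
    have shift: "\<sigma> ` {n + 1..2 * n} = (\<lambda>k. \<sigma> (n + k)) ` {1..n}"
    proof -
      have "{n + 1..2 * n} = (+) n ` {1..n}" by (simp add: mult_2)
      then show ?thesis by (simp only: image_image)
    qed
    show "component (product.minor ?rows (\<sigma> ` {n + 1..2 * n})) (q, 2 * n) =
        qminor q (2 * n) n (\<lambda>k. k) (\<lambda>k. \<sigma> (n + k))"
      using plucker_perms_D(6)[OF assms(3) that] range[of "{n + 1..2 * n}"] unfolding shift
      by (intro component_minor assms) auto
  qed
  \<comment> \<open>For \<open>D = {1..r}\<close> and \<open>C = {r + 1..2 * n}\<close>, the
    hypothesis \<open>r < n\<close> says that there are more rows than columns in
    \<open>D\<close>.\<close>
  have side: "\<forall>d\<in>{1..r}. \<forall>c\<in>{r + 1..2 * n}. d < c" "sorted_wrt (<) ?rows" "card {1..r} < length ?rows"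
    using assms(3) by (auto simp del: upt_Suc)
  have supp: "product.minor ?rows S = 0" if "finite S" "card S \<noteq> n" for S :: "nat set"
    using that by (intro product.minor_eq_0) auto
  have "(\<Oplus>\<^bsub>?R\<^esub>\<sigma>\<in>plucker_perms n r. (- q) ^ inversions (2 * n) \<sigma> \<odot>\<^bsub>?R\<^esub>
      (qminor q (2 * n) n (\<lambda>k. k) \<sigma> \<otimes>\<^bsub>?R\<^esub> qminor q (2 * n) n (\<lambda>k. k) (\<lambda>k. \<sigma> (n + k)))) = \<zero>\<^bsub>?R\<^esub>"
    using assms(1,3)
      product.plucker_left[OF finite_atLeastAtMost finite_atLeastAtMost side(1,2) subset_refl side(3)]
    by (rule component_sum_plucker_perms)
      (simp_all only: supp not_False_eq_True mult_zero_left times_qmat_product.rep_eq R minors)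
  moreover have "(\<Oplus>\<^bsub>?R\<^esub>\<sigma>\<in>plucker_perms n r. (- inverse q) ^ inversions (2 * n) \<sigma> \<odot>\<^bsub>?R\<^esub>
      (qminor q (2 * n) n (\<lambda>k. k) (\<lambda>k. \<sigma> (n + k)) \<otimes>\<^bsub>?R\<^esub> qminor q (2 * n) n (\<lambda>k. k) \<sigma>)) = \<zero>\<^bsub>?R\<^esub>"
    using assms(1,3)
      product.plucker_right[OF finite_atLeastAtMost finite_atLeastAtMost side(1,2) subset_refl side(3)]
    \<comment> \<open>The minor containing the columns \<open>1, ..., r\<close> is still the first
      argument of \<open>f\<close>, although it is now the right factor.\<close>
    by (rule component_sum_plucker_perms[where c = "\<lambda>q. - inverse q"
          and f = "\<lambda>S T. product.minor ?rows T * product.minor ?rows S"])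
      (simp_all only: supp not_False_eq_True mult_zero_right times_qmat_product.rep_eq R minors)
  \<comment> \<open>The negative exponents of the statement are natural powers of
    \<open>w = - inverse q\<close>.\<close>
  moreover have "(- q) powi (- int m) = (- inverse q) ^ m" for m
    by (simp add: power_int_minus power_inverse[symmetric])
  ultimately show ?thesis by simp
qed

end
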